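(* Along even integers $n\to\infty$, \[ \liminf_{\substack{n\to\infty\\ n\ \mathrm{even}}}\overline\Delta_{\max}(n)\ \ge\ \exp\left(\frac{7}{24}\zeta(3)-\frac{\pi^4}{864}\right)\approx 1.26853. \]
   Context: For points $z_1,\dots,z_n\in\mathbb C$, $\Delta(z_1,\dots,z_n)=\prod_{i\neq j}|z_i-z_j|$. $\Delta_{\max}(n)=\sup\{\Delta(z_1,\dots,z_n): \max_{i,j}|z_i-z_j|\le 2\}$ and $\overline\Delta_{\max}(n)=\Delta_{\max}(n)/n^n$. $\zeta$ is the Riemann zeta function. *)

theory Defs
  imports "HOL-Analysis.Analysis"
begin

(* The product runs over ordered pairs, so each unordered pair contributes twice. *)
definition Delta :: "nat \<Rightarrow> (nat \<Rightarrow> complex) \<Rightarrow> real" where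
  "Delta n z = (\<Prod>(i, j) \<in> {(i, j). i \<in> {1..n} \<and> j \<in> {1..n} \<and> i \<noteq> j}. cmod (z i - z j))"

(* A configuration z_1, ..., z_n is a function on nat of which only the values at 1, ..., n matter;
   the points need not be distinct. *)
definition configs :: "nat \<Rightarrow> (nat \<Rightarrow> complex) set" where
  "configs n = {z. \<forall>i \<in> {1..n}. \<forall>j \<in> {1..n}. cmod (z i - z j) \<le> 2}"

definition Delta_max :: "nat \<Rightarrow> real" where
  "Delta_max n = (SUP z \<in> configs n. Delta n z)"

definition Delta_max_bar :: "nat \<Rightarrow> real" where
  "Delta_max_bar n = Delta_max n / real n ^ n"

(* The next two facts show that the real supremum in Delta_max is a genuine one. *)
lemma configs_nonempty: "configs n \<noteq> {}"
  by (auto simp: configs_def intro!: exI[of _ "\<lambda>_. 0"])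

lemma bdd_above_Delta: "bdd_above (Delta n ` configs n)"
proof (rule bdd_aboveI2)
  fix z assume z: "z \<in> configs n"
  show "Delta n z \<le> (\<Prod>_ \<in> {(i, j). i \<in> {1..n} \<and> j \<in> {1..n} \<and> i \<noteq> j}. 2)"
    unfolding Delta_def by (rule prod_mono) (use z in \<open>auto simp: configs_def\<close>)
qed

(* The Riemann zeta function on the half-line s > 1, where it is given by its Dirichlet series;
   the definition is meaningful for such s only. *)
definition zeta :: "real \<Rightarrow> real" where
  "zeta s = (\<Sum>k. 1 / real (Suc k) powr s)"

end

theory Submission
  imports Defs "HOL-Computational_Algebra.Fundamental_Theorem_Algebra" "HOL-Real_Asymp.Real_Asymp"
begin

text \<open>
  Move the vertices of the regular \<open>n\<close>-gon radially to \<open>(1 + f(t\<^sub>i)/n) cis t\<^sub>i\<close>, \<open>t\<^sub>i = 2\<pi>i/n\<close>, with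
  \<open>f(t + \<pi>) = - f(t)\<close>. Opposite vertices stay at distance 2, and since all other pairs have a slack of
  order \<open>1/n\<^sup>2\<close>, the diameter stays at most 2 for large even \<open>n\<close> as soon as \<open>f\<close> has a Lipschitz constant
  below \<open>\<pi>/2\<close>. For \<open>f(t) = \<Sum> a\<^sub>k cos(kt)\<close> the second order term of the logarithm of the product is, by
  orthogonality of the monomials on the \<open>n\<close>-th roots of unity, exactly \<open>\<Sum> (k - 1) a\<^sub>k\<^sup>2 / 4\<close>, and all other
  terms are of order \<open>1/n\<close>. We take for \<open>f\<close> the triangle wave of frequency 3 and slope \<open>\<plusminus>\<pi>/2\<close>, that is
  \<open>a\<^sub>k = 6/k\<^sup>2\<close> for odd multiples \<open>k\<close> of 3. Its Abel means \<open>a\<^sub>k r\<^bsup>k/3\<^esup>\<close> have slope at most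
  \<open>arctan (2r/(1 - r\<^sup>2)) < \<pi>/2\<close>, which leaves room to truncate them to trigonometric polynomials; letting
  \<open>r \<rightarrow> 1\<close> yields \<open>\<Sum> (1/(3j\<^sup>3) - 1/(9j\<^sup>4))\<close> over odd \<open>j\<close>.
\<close>

section \<open>Roots of unity\<close>

definition unity_root :: "nat \<Rightarrow> nat \<Rightarrow> complex" where
  "unity_root n i = cis (2 * pi * real i / real n)"

lemma norm_unity_root [simp]: "norm (unity_root n i) = 1"
  by (simp add: unity_root_def)

text \<open>The summands are the powers of an \<open>n\<close>-th root of unity \<open>w\<close>.
  Distinct exponents below \<open>n\<close> are not congruent modulo \<open>n\<close>, so
  \<open>w \<noteq> 1\<close> unless \<open>a = b\<close>, and the geometric sum vanishes.\<close>

lemma sum_unity_root_monomials: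
  assumes "a < n" "b < n"
  shows "(\<Sum>i\<in>{1..n}. unity_root n i ^ a * cnj (unity_root n i ^ b)) = (if a = b then of_nat n else 0)"
proof -
  define w where "w = cis (2 * pi * (real a - real b) / real n)"
  have n: "n > 0" using assms by simp
  have "unity_root n i ^ a * cnj (unity_root n i ^ b) = w ^ i" for i
  proof -
    have "unity_root n i ^ a * cnj (unity_root n i ^ b)
        = cis (real a * (2 * pi * real i / real n)) * cis (- (real b * (2 * pi * real i / real n)))"
      by (simp only: unity_root_def Complex.DeMoivre cis_cnj)
    also have "\<dots> = w ^ i"
      unfolding w_def Complex.DeMoivre cis_mult by (simp add: algebra_simps diff_divide_distrib)
    finally show ?thesis .
  qed
  then have eq: "(\<Sum>i\<in>{1..n}. unity_root n i ^ a * cnj (unity_root n i ^ b)) = (\<Sum>i\<in>{1..n}. w ^ i)"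
    by simp
  show ?thesis
  proof (cases "a = b")
    case True
    then have "w = 1" by (simp add: w_def)
    then show ?thesis using eq True by simp
  next
    case False
    have "w \<noteq> 1"
    proof
      assume "w = 1"
      then have "cos (2 * pi * (real a - real b) / real n) = 1"
        by (simp add: w_def complex_eq_iff)
      then obtain m :: int where "2 * pi * (real a - real b) / real n = real_of_int m * 2 * pi"
        by (subst (asm) cos_one_2pi_int) blast
      then have "(2 * pi) * (real a - real b) = (2 * pi) * (real_of_int m * real n)"
        using n by (simp add: field_simps)
      then have "real a - real b = real_of_int m * real n"
        by (subst (asm) mult_cancel_left) simp
      then have "real_of_int (int a - int b) = real_of_int (m * int n)" by simp
      then have "int a - int b = m * int n" by (simp only: of_int_eq_iff)
      then have "int n dvd \<bar>int a - int b\<bar>" by simp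
      moreover have "\<bar>int a - int b\<bar> < int n" using assms by linarith
      moreover have "\<bar>int a - int b\<bar> > 0" using False by simp
      ultimately show False using zdvd_imp_le by fastforce
    qed
    have "w ^ n = cis (2 * pi * real_of_int (int a - int b))"
      using n by (simp add: w_def Complex.DeMoivre)
    then have wn: "w ^ n = 1"
      by (metis Ints_of_int cis_multiple_2pi mult.assoc)
    have "(\<Sum>i\<in>{1..n}. w ^ i) = (\<Sum>i<n. w * w ^ i)"
      by (rule sum.reindex_bij_witness[of _ Suc "\<lambda>i. i - 1"]) (auto simp flip: power_Suc)
    also have "\<dots> = 0"
      using \<open>w \<noteq> 1\<close> wn by (simp add: geometric_sum flip: sum_distrib_left)
    finally show ?thesis using eq False by simp
  qed
qed

section \<open>Distances between the vertices of the regular polygon\<close>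

text \<open>The derivative of x^n - 1 vanishes only at 0, which is not a root; hence all roots are
  simple.\<close>

lemma prod_linear_factors_unity:
  assumes "n > 0"
  shows "(\<Prod>z | z ^ n = 1. [:-z, 1:]) = monom 1 n - (1 :: complex poly)"
proof -
  define q :: "complex poly" where "q = monom 1 n - 1"
  have q: "poly q z = z ^ n - 1" for z by (simp add: q_def poly_monom)
  have deg: "degree (-1 + monom 1 n :: complex poly) = n"
    using assms by (subst degree_add_eq_right) (auto simp: degree_monom_eq)
  have dq: "degree q = n" using deg by (simp add: q_def)
  have lc: "lead_coeff q = 1"
    unfolding dq using assms by (simp add: q_def)
  have pd: "poly (pderiv q) z = of_nat n * z ^ (n - 1)" for z
    by (simp add: q_def pderiv_diff pderiv_monom poly_monom)
  have "rsquarefree q"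
    unfolding rsquarefree_roots
  proof (intro allI notI, elim conjE)
    fix z assume z: "poly q z = 0" "poly (pderiv q) z = 0"
    then have "z = 0" using assms by (auto simp: pd)
    then show False using z assms by (simp add: q power_0_left)
  qed
  from complex_poly_decompose_rsquarefree[OF this]
  show ?thesis unfolding lc by (simp add: q) (simp add: q_def)
qed

text \<open>Write x^n - 1 = (x - w) r(x). Differentiating at \<open>w\<close> leaves r(w) = n
  w^(n-1), and r(w) is the product of the differences w - z.\<close>

lemma prod_norm_diff_unity:
  assumes "n > 0" "w ^ n = (1::complex)"
  shows "(\<Prod>z\<in>{z. z ^ n = 1} - {w}. norm (w - z)) = real n"
proof -
  define r where "r = (\<Prod>z\<in>{z. z ^ n = 1} - {w}. [:-z, 1:])"
  have "monom 1 n - (1 :: complex poly) = [:-w, 1:] * r"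
    unfolding r_def using assms
    by (subst prod_linear_factors_unity[symmetric], simp)
       (subst prod.remove[of _ w], auto simp: finite_roots_unity finite_nth_roots)
  then have "poly (pderiv (monom 1 n - (1 :: complex poly))) w = poly (pderiv ([:-w, 1:] * r)) w"
    by simp
  then have "of_nat n * w ^ (n - 1) = poly r w"
    by (simp add: pderiv_diff pderiv_monom poly_monom pderiv_mult pderiv_pCons pderiv_smult)
  then have "poly r w = of_nat n * w ^ (n - 1)" by simp
  moreover have "norm w = 1" using power_eq_1_iff[OF assms(2)] assms(1) by simp
  ultimately have "norm (poly r w) = real n" by (simp add: norm_mult norm_power)
  then show ?thesis by (simp add: r_def poly_prod prod_norm)
qed

lemma bij_betw_unity_root:
  assumes "n > 0"
  shows "bij_betw (unity_root n) {1..n} {z. z ^ n = 1}"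
proof -
  have "bij_betw (unity_root n) {..<n} {z. z ^ n = 1}"
    using Complex.bij_betw_roots_unity[OF assms] by (simp add: unity_root_def[abs_def])
  \<comment> \<open>The indices start at 1, so \<open>n\<close> stands in for the index 0 of the
    root 1.\<close>
  moreover have "bij_betw (\<lambda>i. if i = n then 0 else i) {1..n} {..<n}"
    using assms by (intro bij_betwI[of _ _ _ "\<lambda>i. if i = 0 then n else i"]) auto
  ultimately have "bij_betw (unity_root n \<circ> (\<lambda>i. if i = n then 0 else i)) {1..n} {z. z ^ n = 1}"
    by (rule bij_betw_trans[rotated])
  then show ?thesis
    by (rule bij_betw_cong[THEN iffD1, rotated]) (use assms in \<open>auto simp: unity_root_def\<close>)
qed

lemma Delta_eq_iterated:
  "Delta n z = (\<Prod>i\<in>{1..n}. \<Prod>j\<in>{1..n} - {i}. cmod (z i - z j))"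
proof -
  have "{(i, j). i \<in> {1..n} \<and> j \<in> {1..n} \<and> i \<noteq> j} = (SIGMA i:{1..n}. {1..n} - {i})"
    by auto
  then show ?thesis unfolding Delta_def
    by (simp only:) (subst prod.Sigma, auto)
qed

text \<open>This is the reference value: each vertex contributes a factor \<open>n\<close>. It
  equals the normalisation in \<open>Delta_max_bar\<close>, so only the effect of the perturbation
  remains to be estimated.\<close>

lemma Delta_unity_root:
  assumes "n > 0"
  shows "Delta n (unity_root n) = real n ^ n"
proof -
  note bij = bij_betw_unity_root[OF assms]
  have "(\<Prod>j\<in>{1..n} - {i}. cmod (unity_root n i - unity_root n j)) = real n" if i: "i \<in> {1..n}" for i
  proof -
    have "bij_betw (unity_root n) ({1..n} - {i}) ({z. z ^ n = 1} - {unity_root n i})"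
      using bij_betw_DiffI[OF bij, of "{i}" "{unity_root n i}"] i
        bij_betw_apply[OF bij i] by (simp add: bij_betw_singletonI)
    then have "(\<Prod>j\<in>{1..n} - {i}. cmod (unity_root n i - unity_root n j))
       = (\<Prod>z\<in>{z. z ^ n = 1} - {unity_root n i}. cmod (unity_root n i - z))"
      by (rule prod.reindex_bij_betw)
    also have "\<dots> = real n"
      using i bij by (intro prod_norm_diff_unity assms) (auto simp: bij_betw_def)
    finally show ?thesis .
  qed
  then show ?thesis by (simp add: Delta_eq_iterated)
qed

section \<open>Orthogonality of monomials in two roots of unity\<close>

lemma sum_swap_pairs:
  "(\<Sum>i\<in>I. \<Sum>j\<in>J. \<Sum>x\<in>X. \<Sum>y\<in>Y. h i j x y) = (\<Sum>x\<in>X. \<Sum>y\<in>Y. \<Sum>i\<in>I. \<Sum>j\<in>J. h i j x y)"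
proof -
  have "(\<Sum>i\<in>I. \<Sum>j\<in>J. \<Sum>x\<in>X. \<Sum>y\<in>Y. h i j x y) = (\<Sum>i\<in>I. \<Sum>x\<in>X. \<Sum>j\<in>J. \<Sum>y\<in>Y. h i j x y)"
    by (rule sum.cong[OF refl], rule sum.swap)
  also have "\<dots> = (\<Sum>x\<in>X. \<Sum>i\<in>I. \<Sum>y\<in>Y. \<Sum>j\<in>J. h i j x y)"
    by (subst sum.swap, rule sum.cong[OF refl], rule sum.cong[OF refl], rule sum.swap)
  also have "\<dots> = (\<Sum>x\<in>X. \<Sum>y\<in>Y. \<Sum>i\<in>I. \<Sum>j\<in>J. h i j x y)"
    by (rule sum.cong[OF refl], rule sum.swap)
  finally show ?thesis .
qed

text \<open>A Parseval identity on pairs of roots of unity, obtained from orthogonality in each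
  variable. Exponents below \<open>n\<close> prevent aliasing.\<close>

lemma sum_unity_root_pair_orthogonal:
  fixes c d :: "nat \<times> nat \<Rightarrow> complex"
  assumes "finite X" "finite Y"
    and "\<And>p q. (p, q) \<in> X \<union> Y \<Longrightarrow> p < n \<and> q < n"
  defines "u \<equiv> unity_root n"
  shows "(\<Sum>i\<in>{1..n}. \<Sum>j\<in>{1..n}.
            (\<Sum>(p, q)\<in>X. c (p, q) * (u i ^ p * u j ^ q)) *
            cnj (\<Sum>(p, q)\<in>Y. d (p, q) * (u i ^ p * u j ^ q)))
         = of_nat n ^ 2 * (\<Sum>x\<in>X \<inter> Y. c x * cnj (d x))"
proof -
  let ?I = "{1..n}"
  have "(\<Sum>i\<in>?I. \<Sum>j\<in>?I.
            (\<Sum>(p, q)\<in>X. c (p, q) * (u i ^ p * u j ^ q)) *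
            cnj (\<Sum>(p, q)\<in>Y. d (p, q) * (u i ^ p * u j ^ q)))
     = (\<Sum>i\<in>?I. \<Sum>j\<in>?I. \<Sum>x\<in>X. \<Sum>y\<in>Y. c x * cnj (d y) *
          ((u i ^ fst x * cnj (u i ^ fst y)) * (u j ^ snd x * cnj (u j ^ snd y))))"
    by (simp add: sum_product case_prod_unfold algebra_simps)
  also have "\<dots> = (\<Sum>x\<in>X. \<Sum>y\<in>Y. \<Sum>i\<in>?I. \<Sum>j\<in>?I. c x * cnj (d y) *
          ((u i ^ fst x * cnj (u i ^ fst y)) * (u j ^ snd x * cnj (u j ^ snd y))))"
    by (rule sum_swap_pairs)
  also have "\<dots> = (\<Sum>x\<in>X. \<Sum>y\<in>Y. c x * cnj (d y) *
          ((\<Sum>i\<in>?I. u i ^ fst x * cnj (u i ^ fst y)) * (\<Sum>j\<in>?I. u j ^ snd x * cnj (u j ^ snd y))))"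
    by (simp only: sum_product) (simp only: sum_distrib_left)
  also have "\<dots> = (\<Sum>x\<in>X. \<Sum>y\<in>Y. if x = y then c x * cnj (d y) * of_nat n ^ 2 else 0)"
  proof (intro sum.cong refl)
    fix x y assume "x \<in> X" "y \<in> Y"
    then have "fst x < n" "snd x < n" "fst y < n" "snd y < n"
      using assms(3)[of "fst x" "snd x"] assms(3)[of "fst y" "snd y"] by auto
    then show "c x * cnj (d y) *
          ((\<Sum>i\<in>?I. u i ^ fst x * cnj (u i ^ fst y)) * (\<Sum>j\<in>?I. u j ^ snd x * cnj (u j ^ snd y)))
        = (if x = y then c x * cnj (d y) * of_nat n ^ 2 else 0)"
      unfolding u_def by (subst (1 2) sum_unity_root_monomials) (auto simp: prod_eq_iff power2_eq_square)
  qed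
  also have "\<dots> = (\<Sum>x\<in>X. if x \<in> Y then c x * cnj (d x) * of_nat n ^ 2 else 0)"
    using assms(2) by (simp add: sum.delta)
  also have "\<dots> = (\<Sum>x\<in>X \<inter> Y. c x * cnj (d x) * of_nat n ^ 2)"
    using assms(1) by (simp add: sum.inter_restrict)
  finally show ?thesis by (simp add: sum_distrib_left mult.commute)
qed

text \<open>A mean is the inner product with the constant monomial, whose exponent pair (0, 0) does
  not occur in \<open>X\<close>.\<close>

lemma sum_unity_root_pair_eq_0:
  assumes "finite X" "\<And>p q. (p, q) \<in> X \<Longrightarrow> p < n \<and> q < n \<and> (p, q) \<noteq> (0, 0)"
  defines "u \<equiv> unity_root n"
  shows "(\<Sum>i\<in>{1..n}. \<Sum>j\<in>{1..n}. \<Sum>(p, q)\<in>X. c (p, q) * (u i ^ p * u j ^ q)) = 0"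
proof (cases "X = {}")
  case False
  then have "n > 0" using assms(2) by fastforce
  have "X \<inter> {(0, 0)} = {}" using assms(2) by auto
  then show ?thesis
    using sum_unity_root_pair_orthogonal[of X "{(0, 0)}" n c "\<lambda>_. 1"] assms \<open>n > 0\<close> by auto
qed simp

text \<open>On the unit circle Re(u^k) u = (u^(k+1) + cnj(u^(k-1))) / 2. The first part is divisible
  by u - v as usual; in the second, u - v = - u v cnj(u - v) trades the conjugate factor for u - v.
  So the relative change of a chord is a polynomial minus a conjugated polynomial.\<close>

lemma of_real_Re_power_diff_quotient:
  fixes u v :: complex
  assumes "norm u = 1" "norm v = 1" "k > 0"
  shows "of_real (Re (u ^ k)) * u - of_real (Re (v ^ k)) * v
       = (u - v) / 2 * ((\<Sum>p\<le>k. u ^ p * v ^ (k - p)) - cnj (\<Sum>p\<in>{1..<k}. u ^ p * v ^ (k - p)))"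
proof -
  obtain m where k: "k = Suc m" using assms(3) by (cases k) auto
  have uu: "u * cnj u = 1" and vv: "v * cnj v = 1"
    using assms by (simp_all flip: complex_norm_square)
  have Re: "of_real (Re x) = (x + cnj x) / 2" for x
    by (simp add: complex_add_cnj)
  have A: "(u - v) * (\<Sum>p\<le>k. u ^ p * v ^ (k - p)) = u ^ Suc k - v ^ Suc k"
    by (simp add: diff_power_eq_sum lessThan_Suc_atMost del: power_Suc)
  \<comment> \<open>Each interior monomial contains the factor u v; what remains is the quotient of
    u^m - v^m by u - v.\<close>
  have shift: "(\<Sum>p\<in>{1..<k}. u ^ p * v ^ (k - p)) = u * v * (\<Sum>p<m. u ^ p * v ^ (m - Suc p))"
  proof -
    have "(\<Sum>p\<in>{1..<k}. u ^ p * v ^ (k - p)) = (\<Sum>p<m. u ^ Suc p * v ^ (k - Suc p))"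
      by (rule sum.reindex_bij_witness[of _ Suc "\<lambda>i. i - 1"]) (auto simp: k)
    also have "\<dots> = (\<Sum>p<m. u * v * (u ^ p * v ^ (m - Suc p)))"
    proof (intro sum.cong refl)
      fix p assume "p \<in> {..<m}"
      then have "k - Suc p = Suc (m - Suc p)" by (auto simp: k)
      then show "u ^ Suc p * v ^ (k - Suc p) = u * v * (u ^ p * v ^ (m - Suc p))"
        by simp
    qed
    finally show ?thesis by (simp add: sum_distrib_left)
  qed
  have B: "(u - v) * (\<Sum>p<m. u ^ p * v ^ (m - Suc p)) = u ^ m - v ^ m"
    by (simp add: power_diff_sumr2 mult.commute)
  have "u - v = - (u * v * cnj (u - v))"
    using uu vv by (simp add: algebra_simps)
  then have "(u - v) * w = - (u * v * cnj (u - v)) * w" for w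
    by (rule arg_cong)
  from this[of "cnj (u * v * (\<Sum>p<m. u ^ p * v ^ (m - Suc p)))"]
  have "(u - v) * cnj (\<Sum>p\<in>{1..<k}. u ^ p * v ^ (k - p))
      = - (u * cnj u * (v * cnj v)) * cnj ((u - v) * (\<Sum>p<m. u ^ p * v ^ (m - Suc p)))"
    unfolding shift complex_cnj_mult by (simp only: mult_ac mult_minus_left mult_minus_right)
  also have "\<dots> = - cnj (u ^ m - v ^ m)"
    unfolding uu vv B by simp
  also have "\<dots> = - (cnj (u ^ k) * u - cnj (v ^ k) * v)"
  proof -
    have "cnj (x ^ k) * x = cnj (x ^ m)" if "x * cnj x = 1" for x
      using that by (simp add: k) (metis mult.commute mult.left_commute mult.right_neutral)
    from this[OF uu] this[OF vv] show ?thesis by simp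
  qed
  finally have C: "(u - v) * cnj (\<Sum>p\<in>{1..<k}. u ^ p * v ^ (k - p)) = - (cnj (u ^ k) * u - cnj (v ^ k) * v)" .
  show ?thesis
    unfolding Re times_divide_eq_left right_diff_distrib A C by (simp add: algebra_simps add_divide_distrib diff_divide_distrib)
qed

section \<open>Second order expansion of the product of distances\<close>

text \<open>From the cubic term on, the series of \<open>Ln (1 + x)\<close> is dominated by a
  geometric series, whose factor 1 / (1 - norm x) is at most 2.\<close>

lemma norm_Ln_one_plus_minus_quadratic:
  fixes x :: complex
  assumes "norm x \<le> 1/2"
  shows "norm (Ln (1 + x) - (x - x\<^sup>2 / 2)) \<le> 2 * norm x ^ 3"
proof -
  have lt: "norm x < 1" using assms by simp
  \<comment> \<open>The term of index 0 is 0, since division by 0 gives 0.\<close>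
  define g where "g = (\<lambda>k. (-1) ^ Suc k / of_nat k * x ^ k)"
  have g: "g sums Ln (1 + x)"
    using Ln_series[OF lt] by (simp add: g_def)
  have "(\<lambda>k. g (k + 3)) sums (Ln (1 + x) - (\<Sum>k<3. g k))"
    by (rule sums_split_initial_segment[OF g])
  also have "(\<Sum>k<3. g k) = x - x\<^sup>2 / 2"
    by (simp add: g_def eval_nat_numeral)
  finally have *: "(\<lambda>k. g (k + 3)) sums (Ln (1 + x) - (x - x\<^sup>2 / 2))" .
  have geo: "(\<lambda>k. norm x ^ 3 * norm x ^ k) sums (norm x ^ 3 * (1 / (1 - norm x)))"
    by (intro sums_mult geometric_sums) (use lt in simp)
  have bd: "norm (g (k + 3)) \<le> norm x ^ 3 * norm x ^ k" for k
  proof -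
    have "norm (g (k + 3)) = norm x ^ (k + 3) / real (k + 3)"
      by (simp add: g_def norm_mult norm_divide norm_power del: of_nat_add)
    also have "\<dots> \<le> norm x ^ (k + 3) / 1"
      by (intro divide_left_mono) auto
    finally show ?thesis by (simp add: power_add mult.commute)
  qed
  have "norm (Ln (1 + x) - (x - x\<^sup>2 / 2)) = norm (\<Sum>k. g (k + 3))"
    using * by (simp add: sums_iff)
  also have "\<dots> \<le> (\<Sum>k. norm x ^ 3 * norm x ^ k)"
    by (intro norm_suminf_le bd sums_summable[OF geo])
  also have "\<dots> = norm x ^ 3 * (1 / (1 - norm x))"
    using geo by (simp add: sums_iff)
  also have "\<dots> \<le> norm x ^ 3 * 2"
    using assms by (intro mult_left_mono) (auto simp: field_simps)
  finally show ?thesis by simp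
qed

lemma ln_norm_one_plus_ge:
  fixes x :: complex
  assumes "norm x \<le> 1/2"
  shows "ln (norm (1 + x)) \<ge> Re x - Re (x\<^sup>2) / 2 - 2 * norm x ^ 3"
proof -
  have "1 + x \<noteq> 0"
  proof
    assume "1 + x = 0"
    then have "x = -1" by (simp add: add_eq_0_iff)
    then show False using assms by simp
  qed
  then have "ln (norm (1 + x)) = Re (Ln (1 + x))" by simp
  moreover have "\<bar>Re (Ln (1 + x) - (x - x\<^sup>2 / 2))\<bar> \<le> 2 * norm x ^ 3"
    using norm_Ln_one_plus_minus_quadratic[OF assms] abs_Re_le_cmod order_trans by blast
  ultimately show ?thesis by simp
qed

text \<open>Regrouping by exponent pairs instead of degrees brings sums of homogeneous polynomials
  into the form that the orthogonality relations take.\<close>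

lemma sum_antidiagonals:
  assumes "finite K" "\<And>k. S k \<subseteq> {..k}"
  shows "(\<Sum>k\<in>K. \<Sum>p\<in>S k. g p (k - p)) = (\<Sum>(p, q)\<in>{(p, q). p + q \<in> K \<and> p \<in> S (p + q)}. g p (q :: nat))"
proof -
  have fin: "finite (S k)" for k using assms(2) finite_subset by blast
  have le: "p \<le> k" if "p \<in> S k" for p k using that assms(2) by auto
  have "(\<Sum>k\<in>K. \<Sum>p\<in>S k. g p (k - p)) = (\<Sum>(k, p)\<in>(SIGMA k:K. S k). g p (k - p))"
    using assms(1) fin by (intro sum.Sigma) auto
  also have "\<dots> = (\<Sum>(p, q)\<in>{(p, q). p + q \<in> K \<and> p \<in> S (p + q)}. g p q)"
    by (rule sum.reindex_bij_witness[of _ "\<lambda>(p, q). (p + q, p)" "\<lambda>(k, p). (p, k - p)"]) (auto simp: le)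
  finally show ?thesis .
qed

lemma finite_antidiagonals:
  assumes "finite K" "\<And>k. S k \<subseteq> {..k}"
  shows "finite {(p, q). p + q \<in> K \<and> p \<in> S (p + (q::nat))}"
proof (rule finite_subset)
  show "{(p, q). p + q \<in> K \<and> p \<in> S (p + q)} \<subseteq> {..Max (insert 0 K)} \<times> {..Max (insert 0 K)}"
    using assms(1) by (auto intro: Max_ge order.trans[OF le_add1] order.trans[OF le_add2])
qed (use assms in auto)

definition cos_poly :: "nat set \<Rightarrow> (nat \<Rightarrow> real) \<Rightarrow> real \<Rightarrow> real" where
  "cos_poly K a t = (\<Sum>k\<in>K. a k * cos (real k * t))"

definition perturbed_polygon :: "nat set \<Rightarrow> (nat \<Rightarrow> real) \<Rightarrow> nat \<Rightarrow> nat \<Rightarrow> complex" where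
  "perturbed_polygon K a n i =
     of_real (1 + cos_poly K a (2 * pi * real i / real n) / real n) * unity_root n i"

text \<open>The chord from \<open>i\<close> to \<open>j\<close> is multiplied by
  \<open>1 + D i j / n\<close>, and the logarithms of these factors are expanded to second order.
  The linear terms sum to 0; of the square of \<open>D = A - cnj E\<close> only the cross term
  survives, and it yields \<open>G\<close>. The diagonal and the cubic remainder make up the error
  of order 1/n.\<close>

lemma Delta_perturbed_polygon_ge:
  fixes K :: "nat set" and a :: "nat \<Rightarrow> real" and n :: nat
  defines "G \<equiv> \<Sum>k\<in>K. (real k - 1) * (a k)\<^sup>2 / 4"
    and "B \<equiv> \<Sum>k\<in>K. \<bar>a k\<bar> * real k"
  assumes K: "finite K" "0 \<notin> K" and n: "n > 0" "\<And>k. k \<in> K \<Longrightarrow> 2 * k < n" and B: "B / n \<le> 1 / 2"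
  shows "Delta n (perturbed_polygon K a n) \<ge> real n ^ n * exp (G - (B\<^sup>2 / 2 + 2 * B ^ 3) / n)"
proof -
  define u where "u = unity_root n"
  define c where "c = (\<lambda>(p, q). complex_of_real (a (p + q) / 2))"
  \<comment> \<open>\<open>X\<close> holds the exponent pairs of all degrees in \<open>K\<close>,
    and \<open>Y\<close> those with both exponents positive, as in the two sums of the difference
    quotient.\<close>
  define X where "X = {(p, q). p + q \<in> K \<and> p \<in> {..p + q}}"
  define Y where "Y = {(p, q). p + q \<in> K \<and> p \<in> {1..<p + q}}"
  define A where "A = (\<lambda>i j. \<Sum>(p, q)\<in>X. c (p, q) * (u i ^ p * u j ^ q))"
  define E where "E = (\<lambda>i j. \<Sum>(p, q)\<in>Y. c (p, q) * (u i ^ p * u j ^ q))"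
  define D where "D = (\<lambda>i j. A i j - cnj (E i j))"
  let ?I = "{1..n}"
  have norm_u [simp]: "norm (u i) = 1" for i by (simp add: u_def)
  have finX: "finite X" unfolding X_def by (rule finite_antidiagonals) (use K in auto)
  have finY: "finite Y" unfolding Y_def by (rule finite_antidiagonals) (use K in auto)
  have YX: "Y \<subseteq> X" by (auto simp: X_def Y_def)
  have cnj_c: "cnj (c x) = c x" for x by (simp add: c_def case_prod_unfold)
  \<comment> \<open>The bound is on doubled exponents because monomials are multiplied with each
    other in the squares of \<open>A\<close> and \<open>E\<close>.\<close>
  have less: "2 * p < n \<and> 2 * q < n \<and> (p, q) \<noteq> (0, 0)" if "(p, q) \<in> X" for p q
    using that K(2) n(2)[of "p + q"] by (auto simp: X_def intro!: gr0I)

  have A: "A i j = (\<Sum>k\<in>K. of_real (a k) / 2 * (\<Sum>p\<le>k. u i ^ p * u j ^ (k - p)))" for i j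
    unfolding A_def X_def
    by (subst sum_antidiagonals[symmetric, OF K(1)]) (auto simp: c_def sum_distrib_left)
  have E: "E i j = (\<Sum>k\<in>K. of_real (a k) / 2 * (\<Sum>p\<in>{1..<k}. u i ^ p * u j ^ (k - p)))" for i j
    unfolding E_def Y_def
    by (subst sum_antidiagonals[symmetric, OF K(1)]) (auto simp: c_def sum_distrib_left)
  have D: "D i j = (\<Sum>k\<in>K. of_real (a k) / 2 * ((\<Sum>p\<le>k. u i ^ p * u j ^ (k - p))
              - cnj (\<Sum>p\<in>{1..<k}. u i ^ p * u j ^ (k - p))))" for i j
    unfolding D_def A E by (simp add: sum_subtractf right_diff_distrib)

  have norm_D: "norm (D i j) \<le> B" for i j
    unfolding D B_def
  proof (rule sum_norm_le)
    fix k assume "k \<in> K"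
    then have k: "k > 0" using K(2) by (cases k) auto
    \<comment> \<open>The two sums have k + 1 and k - 1 terms of norm 1, together 2 k.\<close>
    have "norm (\<Sum>p\<le>k. u i ^ p * u j ^ (k - p)) \<le> real k + 1"
      by (rule order.trans[OF norm_sum]) (simp add: norm_mult norm_power)
    moreover have "norm (\<Sum>p\<in>{1..<k}. u i ^ p * u j ^ (k - p)) \<le> real k - 1"
      by (rule order.trans[OF norm_sum]) (use k in \<open>simp add: norm_mult norm_power of_nat_diff\<close>)
    ultimately have "norm ((\<Sum>p\<le>k. u i ^ p * u j ^ (k - p)) - cnj (\<Sum>p\<in>{1..<k}. u i ^ p * u j ^ (k - p)))
        \<le> 2 * real k"
      by (intro order.trans[OF norm_triangle_ineq4]) (simp only: complex_mod_cnj)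
    then have "\<bar>a k\<bar> / 2 * norm ((\<Sum>p\<le>k. u i ^ p * u j ^ (k - p)) - cnj (\<Sum>p\<in>{1..<k}. u i ^ p * u j ^ (k - p)))
        \<le> \<bar>a k\<bar> / 2 * (2 * real k)"
      by (intro mult_left_mono) auto
    then show "norm (of_real (a k) / 2 * ((\<Sum>p\<le>k. u i ^ p * u j ^ (k - p)) - cnj (\<Sum>p\<in>{1..<k}. u i ^ p * u j ^ (k - p))))
        \<le> \<bar>a k\<bar> * real k"
      by (simp add: norm_mult del: cnj_sum)
  qed

  have z_diff: "perturbed_polygon K a n i - perturbed_polygon K a n j = (u i - u j) * (1 + D i j / n)" for i j
  proof -
    have f: "complex_of_real (cos_poly K a (2 * pi * real i / real n)) = (\<Sum>k\<in>K. of_real (a k) * of_real (Re (u i ^ k)))" for i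
      by (simp add: cos_poly_def u_def unity_root_def Complex.DeMoivre)
    have "of_real (cos_poly K a (2 * pi * real i / real n)) * u i - of_real (cos_poly K a (2 * pi * real j / real n)) * u j
        = (\<Sum>k\<in>K. of_real (a k) * (of_real (Re (u i ^ k)) * u i - of_real (Re (u j ^ k)) * u j))"
      unfolding f by (simp add: sum_distrib_right sum_subtractf right_diff_distrib mult.assoc)
    also have "\<dots> = (u i - u j) * D i j"
      unfolding D sum_distrib_left
    proof (intro sum.cong refl)
      fix k assume "k \<in> K"
      then have "k > 0" using K(2) by (cases k) auto
      from of_real_Re_power_diff_quotient[OF norm_u norm_u this]
      show "of_real (a k) * (of_real (Re (u i ^ k)) * u i - of_real (Re (u j ^ k)) * u j)
         = (u i - u j) * (of_real (a k) / 2 * ((\<Sum>p\<le>k. u i ^ p * u j ^ (k - p)) - cnj (\<Sum>p\<in>{1..<k}. u i ^ p * u j ^ (k - p))))"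
        by (simp del: cnj_sum)
    qed
    finally have *: "of_real (cos_poly K a (2 * pi * real i / real n)) * u i
        - of_real (cos_poly K a (2 * pi * real j / real n)) * u j = (u i - u j) * D i j" .
    have "perturbed_polygon K a n i - perturbed_polygon K a n j = (u i - u j)
        + (of_real (cos_poly K a (2 * pi * real i / real n)) * u i
           - of_real (cos_poly K a (2 * pi * real j / real n)) * u j) / n"
      by (simp add: perturbed_polygon_def u_def algebra_simps diff_divide_distrib)
    then show ?thesis unfolding * by (simp add: algebra_simps)
  qed

  have sum_D: "(\<Sum>i\<in>?I. \<Sum>j\<in>?I. D i j) = 0"
  proof -
    have "(\<Sum>i\<in>?I. \<Sum>j\<in>?I. A i j) = 0" unfolding A_def u_def
      by (rule sum_unity_root_pair_eq_0[OF finX]) (use less in fastforce)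
    moreover have "(\<Sum>i\<in>?I. \<Sum>j\<in>?I. E i j) = 0" unfolding E_def u_def
      by (rule sum_unity_root_pair_eq_0[OF finY]) (use less YX in fastforce)
    ultimately show ?thesis by (simp add: D_def sum_subtractf flip: cnj_sum)
  qed

  \<comment> \<open>On the diagonal the monomials collapse to powers with exponent
    \<open>p + q\<close>, strictly between 0 and \<open>n\<close>.\<close>
  have sum_D_diag: "(\<Sum>i\<in>?I. D i i) = 0"
  proof -
    have pow: "(\<Sum>i\<in>?I. u i ^ p * u i ^ q) = 0" if "(p, q) \<in> X" for p q
    proof -
      have "p + q < n" "p + q \<noteq> 0" using that n(2)[of "p + q"] K(2) by (auto simp: X_def intro!: gr0I)
      then show ?thesis using sum_unity_root_monomials[of "p + q" n 0] n by (simp add: u_def power_add)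
    qed
    have "(\<Sum>i\<in>?I. A i i) = (\<Sum>(p, q)\<in>X. c (p, q) * (\<Sum>i\<in>?I. u i ^ p * u i ^ q))"
      unfolding A_def by (subst sum.swap) (simp add: case_prod_unfold sum_distrib_left)
    also have "\<dots> = 0" by (rule sum.neutral) (auto simp: pow[simplified])
    finally have "(\<Sum>i\<in>?I. A i i) = 0" .
    moreover have "(\<Sum>i\<in>?I. E i i) = (\<Sum>(p, q)\<in>Y. c (p, q) * (\<Sum>i\<in>?I. u i ^ p * u i ^ q))"
      unfolding E_def by (subst sum.swap) (simp add: case_prod_unfold sum_distrib_left)
    moreover have "\<dots> = 0" by (rule sum.neutral) (use YX in \<open>auto simp: pow[simplified]\<close>)
    ultimately show ?thesis by (simp add: D_def sum_subtractf flip: cnj_sum)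
  qed

  \<comment> \<open>Without conjugates, a product of two nonconstant monomials is again nonconstant
    with exponents below \<open>n\<close>, so its mean is 0.\<close>
  have sum_sq: "(\<Sum>i\<in>?I. \<Sum>j\<in>?I. (F i j)\<^sup>2) = 0"
    if F: "F = (\<lambda>i j. \<Sum>(p, q)\<in>Z. c (p, q) * (u i ^ p * u j ^ q))" and Z: "Z \<subseteq> X" for F Z
  proof -
    have finZ: "finite Z" using Z finX finite_subset by blast
    have "(F i j)\<^sup>2 = (\<Sum>x\<in>Z. \<Sum>y\<in>Z. c x * c y * (u i ^ (fst x + fst y) * u j ^ (snd x + snd y)))" for i j
      by (simp add: F power2_eq_square sum_product case_prod_unfold power_add algebra_simps)
    then have "(\<Sum>i\<in>?I. \<Sum>j\<in>?I. (F i j)\<^sup>2)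
        = (\<Sum>i\<in>?I. \<Sum>j\<in>?I. \<Sum>x\<in>Z. \<Sum>y\<in>Z. c x * c y * (u i ^ (fst x + fst y) * u j ^ (snd x + snd y)))"
      by simp
    also have "\<dots> = (\<Sum>x\<in>Z. \<Sum>y\<in>Z. c x * c y * (\<Sum>i\<in>?I. \<Sum>j\<in>?I. u i ^ (fst x + fst y) * u j ^ (snd x + snd y)))"
      by (simp only: sum_swap_pairs[of _ Z Z] sum_distrib_left)
    also have "\<dots> = 0"
    proof (intro sum.neutral ballI)
      fix x y assume "x \<in> Z" "y \<in> Z"
      then have "x \<in> X" "y \<in> X" using Z by auto
      then have "2 * fst x < n \<and> 2 * snd x < n \<and> x \<noteq> (0, 0)" "2 * fst y < n \<and> 2 * snd y < n \<and> y \<noteq> (0, 0)"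
        using less[of "fst x" "snd x"] less[of "fst y" "snd y"] by auto
      then have "fst x + fst y < n" "snd x + snd y < n" "fst x + fst y \<noteq> 0 \<or> snd x + snd y \<noteq> 0"
        by (auto simp: prod_eq_iff)
      then have "(\<Sum>i\<in>?I. \<Sum>j\<in>?I. u i ^ (fst x + fst y) * u j ^ (snd x + snd y)) = 0"
        using sum_unity_root_pair_eq_0[of "{(fst x + fst y, snd x + snd y)}" n "\<lambda>_. 1"] by (auto simp: u_def)
      then show "c x * c y * (\<Sum>i\<in>?I. \<Sum>j\<in>?I. u i ^ (fst x + fst y) * u j ^ (snd x + snd y)) = 0" by simp
    qed
    finally show ?thesis .
  qed

  \<comment> \<open>\<open>A\<close> and \<open>E\<close> share their coefficients on
    \<open>Y\<close>, so each degree \<open>k\<close> contributes \<open>(a k / 2)\<^sup>2\<close>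
    once for each of its \<open>k - 1\<close> interior exponent pairs.\<close>
  have sum_AE: "(\<Sum>i\<in>?I. \<Sum>j\<in>?I. A i j * cnj (E i j)) = of_real (real n ^ 2 * G)"
  proof -
    have "(\<Sum>i\<in>?I. \<Sum>j\<in>?I. A i j * cnj (E i j)) = of_nat n ^ 2 * (\<Sum>x\<in>X \<inter> Y. c x * cnj (c x))"
      unfolding A_def E_def u_def
      by (rule sum_unity_root_pair_orthogonal[OF finX finY]) (use less YX in fastforce)
    also have "(\<Sum>x\<in>X \<inter> Y. c x * cnj (c x)) = (\<Sum>(p, q)\<in>Y. of_real ((a (p + q))\<^sup>2 / 4))"
      using YX by (intro sum.cong) (auto simp: cnj_c c_def power2_eq_square)
    also have "\<dots> = (\<Sum>k\<in>K. \<Sum>p\<in>{1..<k}. of_real ((a k)\<^sup>2 / 4))"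
      unfolding Y_def by (subst sum_antidiagonals[symmetric, OF K(1)]) (auto intro!: sum.cong)
    also have "\<dots> = of_real G"
      unfolding G_def of_real_sum
    proof (intro sum.cong refl)
      fix k assume "k \<in> K"
      then have "k > 0" using K(2) by (cases k) auto
      then show "(\<Sum>p\<in>{1..<k}. complex_of_real ((a k)\<^sup>2 / 4)) = of_real ((real k - 1) * (a k)\<^sup>2 / 4)"
        by (simp add: of_nat_diff)
    qed
    finally show ?thesis by simp
  qed

  have sum_D2: "(\<Sum>i\<in>?I. \<Sum>j\<in>?I. Re ((D i j)\<^sup>2)) = - 2 * real n ^ 2 * G"
  proof -
    have "(\<Sum>i\<in>?I. \<Sum>j\<in>?I. (D i j)\<^sup>2)
        = (\<Sum>i\<in>?I. \<Sum>j\<in>?I. (A i j)\<^sup>2) + cnj (\<Sum>i\<in>?I. \<Sum>j\<in>?I. (E i j)\<^sup>2)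
          - 2 * (\<Sum>i\<in>?I. \<Sum>j\<in>?I. A i j * cnj (E i j))"
      by (simp add: D_def power2_diff sum.distrib sum_subtractf sum_distrib_left mult.assoc)
    also have "\<dots> = of_real (- 2 * real n ^ 2 * G)"
      unfolding sum_sq[OF A_def subset_refl] sum_sq[OF E_def YX] sum_AE by simp
    finally have "Re (\<Sum>i\<in>?I. \<Sum>j\<in>?I. (D i j)\<^sup>2) = - 2 * real n ^ 2 * G"
      by (simp only: Re_complex_of_real)
    then show ?thesis by simp
  qed

  have off_diag: "(\<Sum>i\<in>?I. \<Sum>j\<in>?I - {i}. g i j) = (\<Sum>i\<in>?I. \<Sum>j\<in>?I. g i j) - (\<Sum>i\<in>?I. g i i)"
    for g :: "nat \<Rightarrow> nat \<Rightarrow> real"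
  proof -
    have "(\<Sum>i\<in>?I. \<Sum>j\<in>?I - {i}. g i j) = (\<Sum>i\<in>?I. (\<Sum>j\<in>?I. g i j) - g i i)"
      by (intro sum.cong refl) (simp add: sum_diff1)
    then show ?thesis by (simp add: sum_subtractf)
  qed

  have small: "norm (D i j / n) \<le> 1 / 2" for i j
    using norm_D[of i j] B n(1) by (simp add: norm_divide field_simps)
  have pos: "norm (1 + D i j / n) > 0" for i j
  proof -
    have "1 - norm (D i j / n) \<le> norm (1 + D i j / n)"
      using norm_diff_ineq[of 1 "D i j / n"] by simp
    then show ?thesis using small[of i j] by linarith
  qed

  have "G - (B\<^sup>2 / 2 + 2 * B ^ 3) / n \<le> (\<Sum>i\<in>?I. \<Sum>j\<in>?I - {i}. ln (norm (1 + D i j / n)))"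
  proof -
    define h where "h = (\<lambda>i j. Re (D i j) / n - Re ((D i j)\<^sup>2) / (2 * real n ^ 2))"
    have B0: "B \<ge> 0" by (auto simp: B_def intro!: sum_nonneg)
    have ln_ge: "ln (norm (1 + D i j / n)) \<ge> h i j - 2 * B ^ 3 / real n ^ 3" for i j
    proof -
      have "norm (D i j / n) ^ 3 \<le> B ^ 3 / real n ^ 3"
        using norm_D[of i j] by (simp add: norm_divide power_divide divide_right_mono power_mono)
      moreover have "Re (D i j / n) - Re ((D i j / n)\<^sup>2) / 2 = h i j"
        by (simp add: h_def power_divide Re_divide_of_nat flip: of_nat_power)
      ultimately show ?thesis using ln_norm_one_plus_ge[OF small[of i j]] by linarith
    qed
    have "(\<Sum>i\<in>?I. \<Sum>j\<in>?I. h i j) = G"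
    proof -
      have "(\<Sum>i\<in>?I. \<Sum>j\<in>?I. h i j)
        = Re (\<Sum>i\<in>?I. \<Sum>j\<in>?I. D i j) / n - (\<Sum>i\<in>?I. \<Sum>j\<in>?I. Re ((D i j)\<^sup>2)) / (2 * real n ^ 2)"
        by (simp add: h_def sum_subtractf sum_divide_distrib)
      then show ?thesis unfolding sum_D sum_D2 using n(1) by (simp add: field_simps)
    qed
    \<comment> \<open>The sum over all pairs is exactly \<open>G\<close>, so the diagonal has to be
      taken out again. Its linear part vanishes, and its quadratic part is bounded
      trivially.\<close>
    moreover have "(\<Sum>i\<in>?I. h i i) \<le> B\<^sup>2 / 2 / n"
    proof -
      have "(\<Sum>i\<in>?I. h i i) = Re (\<Sum>i\<in>?I. D i i) / n - (\<Sum>i\<in>?I. Re ((D i i)\<^sup>2)) / (2 * real n ^ 2)"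
        by (simp add: h_def sum_subtractf sum_divide_distrib)
      also have "\<dots> = (\<Sum>i\<in>?I. - Re ((D i i)\<^sup>2)) / (2 * real n ^ 2)"
        unfolding sum_D_diag by (simp add: sum_negf)
      also have "\<dots> \<le> (\<Sum>i\<in>?I. B\<^sup>2) / (2 * real n ^ 2)"
      proof (intro divide_right_mono sum_mono)
        fix i
        have "- Re ((D i i)\<^sup>2) \<le> norm ((D i i)\<^sup>2)"
          using abs_Re_le_cmod[of "(D i i)\<^sup>2"] by linarith
        also have "\<dots> \<le> B\<^sup>2"
          using norm_D[of i i] by (simp add: norm_power power_mono)
        finally show "- Re ((D i i)\<^sup>2) \<le> B\<^sup>2" .
      qed simp
      also have "\<dots> = B\<^sup>2 / 2 / n" using n(1) by (simp add: field_simps power2_eq_square)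
      finally show ?thesis .
    qed
    moreover have "(\<Sum>i\<in>?I. \<Sum>j\<in>?I - {i}. 2 * B ^ 3 / real n ^ 3) \<le> 2 * B ^ 3 / n"
    proof -
      have "(\<Sum>i\<in>?I. \<Sum>j\<in>?I - {i}. 2 * B ^ 3 / real n ^ 3) \<le> (\<Sum>i\<in>?I. \<Sum>j\<in>?I. 2 * B ^ 3 / real n ^ 3)"
        using B0 by (intro sum_mono sum_mono2) auto
      also have "\<dots> = 2 * B ^ 3 / n"
        using n(1) by (simp add: field_simps power3_eq_cube)
      finally show ?thesis .
    qed
    moreover have "(\<Sum>i\<in>?I. \<Sum>j\<in>?I - {i}. h i j) - (\<Sum>i\<in>?I. \<Sum>j\<in>?I - {i}. 2 * B ^ 3 / real n ^ 3)
        \<le> (\<Sum>i\<in>?I. \<Sum>j\<in>?I - {i}. ln (norm (1 + D i j / n)))"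
      unfolding sum_subtractf[symmetric] by (intro sum_mono ln_ge)
    ultimately show ?thesis unfolding off_diag by (simp add: add_divide_distrib)
  qed
  then have "exp (G - (B\<^sup>2 / 2 + 2 * B ^ 3) / n) \<le> exp (\<Sum>i\<in>?I. \<Sum>j\<in>?I - {i}. ln (norm (1 + D i j / n)))"
    by simp
  also have "\<dots> = (\<Prod>i\<in>?I. \<Prod>j\<in>?I - {i}. norm (1 + D i j / n))"
    using pos by (simp add: exp_sum)
  finally have "real n ^ n * exp (G - (B\<^sup>2 / 2 + 2 * B ^ 3) / n)
      \<le> Delta n u * (\<Prod>i\<in>?I. \<Prod>j\<in>?I - {i}. norm (1 + D i j / n))"
    unfolding u_def Delta_unity_root[OF n(1)] by (intro mult_left_mono) (auto simp: u_def)
  also have "\<dots> = Delta n (perturbed_polygon K a n)"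
    unfolding Delta_eq_iterated z_diff norm_mult prod.distrib ..
  finally show ?thesis .
qed

section \<open>The diameter of the perturbed polygon\<close>

lemma sin_taylor_7_bounds:
  fixes x :: real
  assumes "0 \<le> x" "x \<le> 1"
  shows "sin x \<le> x - x ^ 3 / 6 + x ^ 5 / 120 - x ^ 7 / 5040 + x ^ 9 / 362880"
    and "sin x \<ge> x - x ^ 3 / 6 + x ^ 5 / 120 - x ^ 7 / 5040 - x ^ 9 / 362880"
proof -
  have "\<bar>sin x - (\<Sum>m<9. sin_coeff m * x ^ m)\<bar> \<le> inverse (fact 9) * \<bar>x\<bar> ^ 9"
    by (rule Maclaurin_sin_bound)
  moreover have "(\<Sum>m<9. sin_coeff m * x ^ m) = x - x ^ 3 / 6 + x ^ 5 / 120 - x ^ 7 / 5040"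
    by (simp add: lessThan_nat_numeral sin_coeff_def fact_numeral)
  moreover have "inverse (fact 9) * \<bar>x\<bar> ^ 9 = x ^ 9 / 362880"
    using assms by (simp add: fact_numeral field_simps)
  ultimately have "\<bar>sin x - (x - x ^ 3 / 6 + x ^ 5 / 120 - x ^ 7 / 5040)\<bar> \<le> x ^ 9 / 362880"
    by simp
  then show "sin x \<le> x - x ^ 3 / 6 + x ^ 5 / 120 - x ^ 7 / 5040 + x ^ 9 / 362880"
    and "sin x \<ge> x - x ^ 3 / 6 + x ^ 5 / 120 - x ^ 7 / 5040 - x ^ 9 / 362880"
    by linarith+
qed

text \<open>The Taylor bounds at the two rational points divided by 6 fall on either side of 1/2 =
  sin(pi/6), and the sine is increasing there.\<close>

lemma pi_bounds: "3.141592 < pi" "pi < 3.141593"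
proof -
  have "sin (3.141592 / 6 :: real) < 1 / 2"
    using sin_taylor_7_bounds(1)[of "3.141592 / 6"] by (simp add: power_divide)
  then have "\<not> pi / 6 \<le> 3.141592 / 6"
    using sin_monotone_2pi_le[of "pi / 6" "3.141592 / 6"] pi_ge_two by (auto simp: sin_30)
  then show "3.141592 < pi" by simp
  have "1 / 2 < sin (3.141593 / 6 :: real)"
    using sin_taylor_7_bounds(2)[of "3.141593 / 6"] by (simp add: power_divide)
  then have "\<not> 3.141593 / 6 \<le> pi / 6"
    using sin_monotone_2pi_le[of "3.141593 / 6" "pi / 6"] pi_ge_two by (auto simp: sin_30)
  then show "pi < 3.141593" by simp
qed

text \<open>For use with \<open>y = pi / n\<close>, the least nonzero half angle \<open>x\<close>;
  the lower bound is linear in \<open>x\<close>, like the Lipschitz bound it has to beat. It follows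
  from y - y^3/3 \<le> x - x^3/3 and x^2 - x^4/3 \<le> (x - x^3/6)^2.\<close>

lemma sin_squared_ge_cubic:
  fixes x y :: real
  assumes "0 < y" "y \<le> x" "x \<le> pi / 2" "y \<le> 1 / 4"
  shows "x * (y - y ^ 3 / 3) \<le> (sin x)\<^sup>2"
proof -
  \<comment> \<open>As 1.575 exceeds pi/2, the bound \<open>y \<le> 1 / 4\<close> keeps x^2 + x y +
    y^2 below 3.\<close>
  have x: "0 < x" "x \<le> 1.575" using assms pi_bounds by auto
  have x2: "x\<^sup>2 \<le> 1.575\<^sup>2" using x by (intro power_mono) auto
  have xy: "x * y \<le> 1.575 * (1 / 4)" using x assms by (intro mult_mono) auto
  have y2: "y\<^sup>2 \<le> (1 / 4)\<^sup>2" using assms by (intro power_mono) auto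
  have "0 \<le> (x - y) * (1 - (x\<^sup>2 + x * y + y\<^sup>2) / 3)"
    using x2 xy y2 assms by (intro mult_nonneg_nonneg) (auto simp: power2_eq_square)
  then have "0 \<le> x * ((x - y) * (1 - (x\<^sup>2 + x * y + y\<^sup>2) / 3))"
    using x by simp
  also have "\<dots> = (x\<^sup>2 - x ^ 4 / 3) - x * (y - y ^ 3 / 3)"
    by (simp add: field_simps power2_eq_square power3_eq_cube power4_eq_xxxx)
  finally have "x * (y - y ^ 3 / 3) \<le> x\<^sup>2 - x ^ 4 / 3"
    by simp
  also have "\<dots> \<le> x\<^sup>2 - x ^ 4 / 3 + (x ^ 3 / 6)\<^sup>2"
    by simp
  also have "\<dots> = (x - x ^ 3 / 6)\<^sup>2"
    by (simp add: power2_eq_square power3_eq_cube power4_eq_xxxx algebra_simps)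
  also have "\<dots> \<le> (sin x)\<^sup>2"
  proof (rule power_mono)
    have "\<bar>sin x - (\<Sum>m<3. sin_coeff m * x ^ m)\<bar> \<le> inverse (fact 3) * \<bar>x\<bar> ^ 3"
      by (rule Maclaurin_sin_bound)
    moreover have "(\<Sum>m<3. sin_coeff m * x ^ m) = x"
      by (simp add: lessThan_nat_numeral sin_coeff_def)
    moreover have "inverse (fact 3) * \<bar>x\<bar> ^ 3 = x ^ 3 / 6"
      using x by (simp add: fact_numeral)
    ultimately show "x - x ^ 3 / 6 \<le> sin x" by linarith
    have "0 \<le> x * (1 - x\<^sup>2 / 6)"
      using x x2 by (intro mult_nonneg_nonneg) (auto simp: power2_eq_square)
    then show "0 \<le> x - x ^ 3 / 6" by (simp add: algebra_simps power2_eq_square power3_eq_cube)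
  qed
  finally show ?thesis .
qed

text \<open>The law of cosines in half-angle form. It is applied to one vertex and the negative of
  another, so \<open>s\<close> measures the deviation from exact opposition.\<close>

lemma cmod_add_cis_squared:
  "(cmod (of_real r * cis t + of_real q * cis (t + s)))\<^sup>2 = (r + q)\<^sup>2 - 4 * r * q * (sin (s / 2))\<^sup>2"
proof -
  have "of_real r * cis t + of_real q * cis (t + s) = cis t * (of_real r + of_real q * cis s)"
    by (simp add: algebra_simps flip: cis_mult)
  then have "(cmod (of_real r * cis t + of_real q * cis (t + s)))\<^sup>2 = (cmod (of_real r + of_real q * cis s))\<^sup>2"
    by (simp add: norm_mult)
  also have "\<dots> = (r + q * cos s)\<^sup>2 + (q * sin s)\<^sup>2"
    by (simp add: cmod_power2)
  also have "\<dots> = r\<^sup>2 + q\<^sup>2 * ((sin s)\<^sup>2 + (cos s)\<^sup>2) + 2 * r * q * cos s"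
    by algebra
  also have "\<dots> = r\<^sup>2 + q\<^sup>2 + 2 * r * q * cos s"
    by simp
  also have "cos s = 1 - 2 * (sin (s / 2))\<^sup>2"
    using cos_double_sin[of "s / 2"] by simp
  finally show ?thesis by (simp add: power2_eq_square algebra_simps)
qed

section \<open>Symmetries of cosine polynomials and the diameter estimate\<close>

lemma cos_poly_periodic:
  "cos_poly K a (t + 2 * pi * of_int q) = cos_poly K a t"
  unfolding cos_poly_def
proof (intro sum.cong refl)
  fix k
  have "cos (real k * (t + 2 * pi * of_int q)) = cos (real k * t + 2 * pi * of_int (int k * q))"
    by (simp add: algebra_simps)
  also have "\<dots> = cos (real k * t)"
    by (simp only: cos_add sin_int_2pin cos_int_2pin mult_1_right mult_zero_right diff_zero)
  finally show "a k * cos (real k * (t + 2 * pi * of_int q)) = a k * cos (real k * t)"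
    by simp
qed

lemma cos_poly_antiperiodic:
  assumes "\<And>k. k \<in> K \<Longrightarrow> odd k"
  shows "cos_poly K a (t + pi) = - cos_poly K a t"
  unfolding cos_poly_def sum_negf[symmetric]
proof (intro sum.cong refl)
  fix k assume "k \<in> K"
  then have "cos (real k * t + real k * pi) = - cos (real k * t)"
    using assms by (simp add: cos_add)
  then show "a k * cos (real k * (t + pi)) = - (a k * cos (real k * t))"
    by (simp add: algebra_simps)
qed

lemma abs_cos_poly_le: "\<bar>cos_poly K a t\<bar> \<le> (\<Sum>k\<in>K. \<bar>a k\<bar>)"
  unfolding cos_poly_def
  by (rule order.trans[OF sum_abs]) (auto intro!: sum_mono simp: abs_mult mult_left_le)

text \<open>Vertex \<open>j\<close> is located relative to the antipode of vertex \<open>i\<close>,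
  at angle \<open>\<phi>\<close>. Radial displacement lengthens the chord by at most a multiple of
  \<open>s * \<bar>\<phi>\<bar> / n\<close>, while the angle shortens it by an amount that is also
  at least linear in \<open>\<bar>\<phi>\<bar>\<close>, as \<open>\<phi>\<close> is a multiple of 2
  pi / n. The hypothesis \<open>le\<close> compares the two slopes; to leading order it says 2 s
  \<le> pi.\<close>

lemma perturbed_polygon_in_configs:
  fixes K :: "nat set" and a :: "nat \<Rightarrow> real" and n :: nat and s :: real
  defines "B \<equiv> \<Sum>k\<in>K. \<bar>a k\<bar>"
  assumes odd: "\<And>k. k \<in> K \<Longrightarrow> odd k"
    and lip: "\<And>t t'. \<bar>cos_poly K a t - cos_poly K a t'\<bar> \<le> s * \<bar>t - t'\<bar>"
    and n: "even n" "n \<ge> 13" "B < n"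
    and le: "2 * s * (1 + B / (2 * n)) \<le> pi * ((1 - B / n)\<^sup>2 * (1 - (pi / n)\<^sup>2 / 3))"
  shows "perturbed_polygon K a n \<in> configs n"
proof -
  define f where "f = cos_poly K a"
  have f_le: "\<bar>f t\<bar> \<le> B" for t unfolding f_def B_def by (rule abs_cos_poly_le)
  have "s \<ge> 0"
    using order.trans[OF abs_ge_zero lip[of 1 0]] by simp
  have "cmod (perturbed_polygon K a n i - perturbed_polygon K a n j) \<le> 2" for i j
  proof -
    define h where "h = int n div 2"
    have h: "int n = 2 * h" using n(1) by (simp add: h_def)
    \<comment> \<open>\<open>m\<close> counts the steps from the antipode of vertex \<open>i\<close>
      to vertex \<open>j\<close>, up to \<open>q\<close> full turns.\<close>
    define m where "m = (int j - int i) mod int n - h"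
    define q where "q = (int j - int i) div int n"
    have "int j - int i = int n * q + (m + h)"
      by (simp add: m_def q_def)
    then have j: "real j = real i + real n * of_int q + of_int m + real n / 2"
    proof -
      have "real_of_int (int j - int i) = real_of_int (int n * q + (m + h))"
        using \<open>int j - int i = int n * q + (m + h)\<close> by simp
      moreover have "real_of_int (int n) = real_of_int (2 * h)" using h by simp
      ultimately show ?thesis by simp
    qed
    have m: "\<bar>m\<bar> \<le> h"
    proof -
      have "0 \<le> (int j - int i) mod int n" "(int j - int i) mod int n < int n"
        using n(2) by simp_all
      then show ?thesis using h unfolding m_def by linarith
    qed
    define t where "t = 2 * pi * real i / real n"
    define \<phi> where "\<phi> = 2 * pi * of_int m / real n"
    have tj: "2 * pi * real j / real n = (t + \<phi> + pi) + 2 * pi * of_int q"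
      unfolding j t_def \<phi>_def using n by (simp add: field_simps)
    \<comment> \<open>These are the relative radial displacements of the two vertices. By
      antiperiodicity their sum \<open>d\<close> is a difference of values of \<open>f\<close>,
      which the Lipschitz bound controls.\<close>
    define a' where "a' = f t / n"
    define b' where "b' = - f (t + \<phi>) / n"
    define d where "d = a' + b'"
    have fj: "f (2 * pi * real j / real n) = - f (t + \<phi>)"
      unfolding tj f_def cos_poly_periodic by (rule cos_poly_antiperiodic[OF odd])
    have uj: "unity_root n j = - cis (t + \<phi>)"
      unfolding unity_root_def tj by (simp add: complex_eq_iff sin_add cos_add sin_int_2pin cos_int_2pin)
    have "perturbed_polygon K a n i - perturbed_polygon K a n j
        = of_real (1 + a') * cis t + of_real (1 + b') * cis (t + \<phi>)"
      unfolding perturbed_polygon_def f_def[symmetric] fj uj by (simp add: a'_def b'_def unity_root_def flip: t_def)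
    then have "(cmod (perturbed_polygon K a n i - perturbed_polygon K a n j))\<^sup>2
        = (2 + d)\<^sup>2 - 4 * (1 + a') * (1 + b') * (sin (\<phi> / 2))\<^sup>2"
      by (simp only: cmod_add_cis_squared) (simp add: d_def)
    also have "\<dots> \<le> 2\<^sup>2"
    proof (cases "m = 0")
      \<comment> \<open>For opposite vertices the displacements cancel, and the distance is exactly
        2.\<close>
      case True
      then show ?thesis by (simp add: \<phi>_def d_def a'_def b'_def)
    next
      case False
      define x where "x = \<bar>\<phi>\<bar> / 2"
      define y where "y = pi / n"
      have xm: "x = y * \<bar>of_int m\<bar>"
        by (simp add: x_def y_def \<phi>_def abs_mult)
      \<comment> \<open>13 is the least \<open>n\<close> with pi / n \<le> 1/4.\<close>
      have y: "0 < y" "y \<le> 1 / 4"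
        using n(2) pi_bounds by (auto simp: y_def field_simps)
      have "y * 1 \<le> x" unfolding xm using y False by (intro mult_left_mono) auto
      moreover have "x \<le> y * of_int h" unfolding xm using m y by (intro mult_left_mono) auto
      moreover have "y * of_int h = pi / 2"
      proof -
        have "real_of_int (int n) = real_of_int (2 * h)" using h by simp
        then have "real n = 2 * of_int h" by simp
        then show ?thesis using n(2) by (simp add: y_def)
      qed
      ultimately have x: "y \<le> x" "x \<le> pi / 2" by auto
      have "sin (\<phi> / 2) = sin x \<or> sin (\<phi> / 2) = - sin x"
        by (cases "\<phi> \<ge> 0") (auto simp: x_def)
      then have sin2: "(sin (\<phi> / 2))\<^sup>2 = (sin x)\<^sup>2" by auto
      have B0: "B \<ge> 0" by (simp add: B_def sum_nonneg)
      have bd: "- (B / n) \<le> a'" "- (B / n) \<le> b'" "a' \<le> B / n" "b' \<le> B / n"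
        using f_le[of t] f_le[of "t + \<phi>"] n(2) by (auto simp: a'_def b'_def field_simps abs_le_iff)
      have d: "\<bar>d\<bar> \<le> 2 * s * x / n"
      proof -
        have "d = (f t - f (t + \<phi>)) / n" by (simp add: d_def a'_def b'_def diff_divide_distrib)
        then have "\<bar>d\<bar> = \<bar>f t - f (t + \<phi>)\<bar> / n" by simp
        also have "\<dots> \<le> s * \<bar>t - (t + \<phi>)\<bar> / n" unfolding f_def by (intro divide_right_mono lip) auto
        finally show ?thesis by (simp add: x_def)
      qed
      have d2: "\<bar>d\<bar> \<le> 2 * (B / n)" using bd by (auto simp: d_def)
      have x0: "0 \<le> x" using x y by linarith
      have "B / n < 1" using n(2,3) by simp
      then have r: "(1 - B / n) * (1 - B / n) \<le> (1 + a') * (1 + b')" "0 \<le> (1 + a') * (1 + b')"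
        using bd by (auto intro!: mult_mono mult_nonneg_nonneg)
      \<comment> \<open>The excess of (2 + d)^2 over 4 is to be absorbed by the sine term.\<close>
      have "4 * d + d\<^sup>2 \<le> \<bar>d\<bar> * (4 + \<bar>d\<bar>)"
        by (simp add: algebra_simps power2_eq_square abs_if)
      also have "\<dots> \<le> (2 * s * x / n) * (4 + 2 * (B / n))"
        using d d2 \<open>s \<ge> 0\<close> x0 by (intro mult_mono) auto
      also have "\<dots> = 4 * (x / n) * (2 * s * (1 + B / (2 * n)))"
        by (simp add: field_simps)
      also have "\<dots> \<le> 4 * (x / n) * (pi * ((1 - B / n)\<^sup>2 * (1 - (pi / n)\<^sup>2 / 3)))"
        using x0 by (intro mult_left_mono le) auto
      also have "\<dots> = 4 * ((1 - B / n) * (1 - B / n)) * (x * (y * (1 - y\<^sup>2 / 3)))"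
        by (simp add: y_def power2_eq_square)
      also have "\<dots> = 4 * ((1 - B / n) * (1 - B / n)) * (x * (y - y ^ 3 / 3))"
      proof -
        have "y * (1 - y\<^sup>2 / 3) = y - y ^ 3 / 3"
          by (simp add: algebra_simps power2_eq_square power3_eq_cube)
        then show ?thesis by (simp only:)
      qed
      also have "\<dots> \<le> 4 * ((1 + a') * (1 + b')) * (sin (\<phi> / 2))\<^sup>2"
      proof (rule mult_mono)
        show "x * (y - y ^ 3 / 3) \<le> (sin (\<phi> / 2))\<^sup>2"
          unfolding sin2 by (rule sin_squared_ge_cubic) (use x y in auto)
        have "0 \<le> y * (1 - y\<^sup>2 / 3)"
          using y power_mono[of y "1/4" 2] by (intro mult_nonneg_nonneg) (auto simp: power2_eq_square)
        then show "0 \<le> x * (y - y ^ 3 / 3)"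
          using x0 by (intro mult_nonneg_nonneg) (auto simp: algebra_simps power2_eq_square power3_eq_cube)
      qed (use r in auto)
      finally show ?thesis by (simp add: power2_eq_square algebra_simps)
    qed
    finally show ?thesis by (simp add: power_mono_iff[symmetric, of _ 2 2] del: power_mono_iff)
  qed
  then show ?thesis by (simp add: configs_def)
qed

section \<open>Abel means of the triangle wave\<close>

lemma sum_odd_powers_of_difference:
  fixes z :: complex
  shows "(\<Sum>n<2 * M. (z ^ n - (- z) ^ n) / of_nat n) = 2 * (\<Sum>m<M. z ^ (2 * m + 1) / of_nat (2 * m + 1))"
  by (induction M) (simp_all add: algebra_simps power_minus')

text \<open>The map (1 + z) / (1 - z) sends the unit disc to the right half-plane, where the
  argument is an arctangent. Both logarithms have imaginary part below pi/2 in absolute value, so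
  their difference is the principal logarithm of the quotient.\<close>

lemma Im_Ln_diff_eq_arctan:
  assumes "norm z < 1"
  shows "Im (Ln (1 + z) - Ln (1 - z)) = arctan (2 * Im z / (1 - (norm z)\<^sup>2))"
proof -
  define L where "L = Ln (1 + z) - Ln (1 - z)"
  have Re: "Re (1 + z) > 0" "Re (1 - z) > 0"
    using abs_Re_le_cmod[of z] assms by auto
  then have nz: "1 + z \<noteq> 0" "1 - z \<noteq> 0"
    by (metis less_irrefl zero_complex.sel(1))+
  have "\<bar>Im (Ln (1 + z))\<bar> < pi / 2" "\<bar>Im (Ln (1 - z))\<bar> < pi / 2"
    using Re_Ln_pos_lt[OF nz(1)] Re_Ln_pos_lt[OF nz(2)] Re by auto
  then have Im: "- pi < Im L" "Im L \<le> pi" by (auto simp: L_def)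
  have n2: "0 < 1 - (norm z)\<^sup>2" using assms by (simp add: power_less_one_iff abs_square_less_1)
  define c where "c = (norm (1 - z))\<^sup>2"
  have c: "c > 0" using nz by (simp add: c_def)
  have "exp L = (1 + z) / (1 - z)"
    using nz by (simp add: L_def exp_diff)
  also have "\<dots> = (1 + z) * cnj (1 - z) / of_real c"
    by (simp add: c_def complex_div_cnj[of "1 + z"])
  also have "(1 + z) * cnj (1 - z) = Complex (1 - (norm z)\<^sup>2) (2 * Im z)"
    unfolding cmod_power2 by (simp add: complex_eq_iff power2_eq_square algebra_simps)
  finally have w: "exp L = Complex ((1 - (norm z)\<^sup>2) / c) (2 * Im z / c)"
    by (simp add: complex_eq_iff)
  have "Im L = Im (Ln (exp L))" using Im by (simp add: Ln_exp)
  also have "\<dots> = arctan (Im (exp L) / Re (exp L))"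
    using n2 c by (subst Im_Ln_eq[OF exp_not_eq_zero]) (simp add: w)
  also have "Im (exp L) / Re (exp L) = 2 * Im z / (1 - (norm z)\<^sup>2)"
    using c by (simp add: w)
  finally show ?thesis by (simp add: L_def)
qed

text \<open>The full series is the imaginary part of Ln(1 + z) - Ln(1 - z) at z = r cis t, at most
  the arctangent because |Im z| \<le> r; the tail is geometric. For r = 1 the partial sums would
  exceed pi/2 by the Gibbs phenomenon.\<close>

lemma abs_odd_sine_sum_le:
  assumes r: "0 \<le> r" "r < 1"
  shows "\<bar>2 * (\<Sum>m<M. r ^ (2 * m + 1) * sin (real (2 * m + 1) * t) / real (2 * m + 1))\<bar>
       \<le> arctan (2 * r / (1 - r\<^sup>2)) + 2 * r ^ (2 * M) / (1 - r)"
proof -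
  define z where "z = of_real r * cis t"
  have norm_z: "norm z = r" using r by (simp add: z_def norm_mult)
  define g where "g = (\<lambda>n. (z ^ n - (- z) ^ n) / of_nat n)"
  define L where "L = Ln (1 + z) - Ln (1 - z)"
  have "(\<lambda>n. - ((- z) ^ n) / of_nat n - (- ((- (- z)) ^ n) / of_nat n)) sums (Ln (1 + z) - Ln (1 + (- z)))"
    by (intro sums_diff Ln_series') (use norm_z r in auto)
  then have "g sums L"
    by (simp add: g_def L_def diff_divide_distrib)
  then have tail: "(\<lambda>n. g (n + 2 * M)) sums (L - (\<Sum>n<2 * M. g n))"
    by (rule sums_split_initial_segment)
  have geo: "(\<lambda>n. 2 * r ^ (2 * M) * r ^ n) sums (2 * r ^ (2 * M) * (1 / (1 - r)))"
    by (intro sums_mult geometric_sums) (use r in simp)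
  have "norm (g (n + 2 * M)) \<le> 2 * r ^ (2 * M) * r ^ n" for n
  \<comment> \<open>The term of index 0 is 0 because of the division by 0; elsewhere the denominator
    is at least 1.\<close>
  proof (cases "n + 2 * M = 0")
    case False
    have "norm (g (n + 2 * M)) = norm (z ^ (n + 2 * M) - (- z) ^ (n + 2 * M)) / real (n + 2 * M)"
      by (simp add: g_def norm_divide del: of_nat_add)
    also have "\<dots> \<le> norm (z ^ (n + 2 * M) - (- z) ^ (n + 2 * M)) / 1"
      using False by (intro divide_left_mono) auto
    also have "\<dots> \<le> 2 * r ^ (n + 2 * M)"
      using norm_triangle_ineq4[of "z ^ (n + 2 * M)" "(- z) ^ (n + 2 * M)"]
      by (simp add: norm_power norm_z)
    finally show ?thesis by (simp add: power_add mult_ac)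
  qed (use r in \<open>simp add: g_def\<close>)
  then have "norm (\<Sum>n. g (n + 2 * M)) \<le> (\<Sum>n. 2 * r ^ (2 * M) * r ^ n)"
    by (intro norm_suminf_le sums_summable[OF geo])
  then have *: "norm (L - (\<Sum>n<2 * M. g n)) \<le> 2 * r ^ (2 * M) / (1 - r)"
    using sums_unique[OF tail] sums_unique[OF geo] by simp
  have "Im (\<Sum>n<2 * M. g n) = 2 * (\<Sum>m<M. Im (z ^ (2 * m + 1) / of_nat (2 * m + 1)))"
    unfolding g_def sum_odd_powers_of_difference by (simp only: Im_sum flip: Im_sum) simp
  also have "(\<Sum>m<M. Im (z ^ (2 * m + 1) / of_nat (2 * m + 1)))
      = (\<Sum>m<M. r ^ (2 * m + 1) * sin (real (2 * m + 1) * t) / real (2 * m + 1))"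
  proof (intro sum.cong refl)
    fix m :: nat
    have "z ^ k = of_real (r ^ k) * cis (real k * t)" for k
      by (simp add: z_def power_mult_distrib Complex.DeMoivre)
    then have "Im (z ^ k) = r ^ k * sin (real k * t)" for k
      by (simp flip: of_real_power)
    then show "Im (z ^ (2 * m + 1) / of_nat (2 * m + 1)) = r ^ (2 * m + 1) * sin (real (2 * m + 1) * t) / real (2 * m + 1)"
      by (simp only: Im_divide_of_nat)
  qed
  finally have eq: "Im (\<Sum>n<2 * M. g n)
      = 2 * (\<Sum>m<M. r ^ (2 * m + 1) * sin (real (2 * m + 1) * t) / real (2 * m + 1))" .
  have "\<bar>Im L - Im (\<Sum>n<2 * M. g n)\<bar> \<le> 2 * r ^ (2 * M) / (1 - r)"
    using order.trans[OF abs_Im_le_cmod *] by simp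
  moreover have "\<bar>Im L\<bar> \<le> arctan (2 * r / (1 - r\<^sup>2))"
  proof -
    have r2: "1 - r\<^sup>2 > 0" using r by (simp add: abs_square_less_1)
    have "\<bar>2 * Im z / (1 - r\<^sup>2)\<bar> \<le> 2 * r / (1 - r\<^sup>2)"
      using abs_Im_le_cmod[of z] r2 unfolding norm_z by (simp add: abs_mult divide_right_mono)
    then have "- (2 * r / (1 - r\<^sup>2)) \<le> 2 * Im z / (1 - r\<^sup>2)" "2 * Im z / (1 - r\<^sup>2) \<le> 2 * r / (1 - r\<^sup>2)"
      by (simp_all only: abs_le_iff) linarith
    then have "arctan (- (2 * r / (1 - r\<^sup>2))) \<le> Im L" "Im L \<le> arctan (2 * r / (1 - r\<^sup>2))"
      unfolding L_def using Im_Ln_diff_eq_arctan[of z] norm_z r by (simp_all only: arctan_le_iff)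
    then show ?thesis by (simp add: arctan_minus abs_le_iff)
  qed
  ultimately show ?thesis unfolding eq[symmetric] by linarith
qed

text \<open>Every frequency \<open>k\<close> is an odd multiple of 3, so the division \<open>k div 3\<close> below is exact.\<close>

definition wave_freqs :: "nat \<Rightarrow> nat set" where
  "wave_freqs M = (\<lambda>m. 3 * (2 * m + 1)) ` {..<M}"

text \<open>A triangle wave of odd frequency m and slope \<plusminus>pi/2 has coefficients 2 m / k^2
  and second order term equal to the sum of 1/(m j^3) - 1/(m^2 j^4) over odd j. Among odd m this is
  largest at m = 3.\<close>

definition wave_coeff :: "real \<Rightarrow> nat \<Rightarrow> real" where
  "wave_coeff r k = 6 * r ^ (k div 3) / (real k)\<^sup>2"

lemma sum_wave_freqs: "(\<Sum>k\<in>wave_freqs M. g k) = (\<Sum>m<M. g (3 * (2 * m + 1)))"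
  unfolding wave_freqs_def by (subst sum.reindex) (auto simp: inj_on_def)

text \<open>Since 6 / (3 j)^2 times 3 j is 2 / j, the derivative is, up to sign, the odd sine sum at
  \<open>3 * t\<close>; its bound carries over by the mean value theorem.\<close>

lemma wave_lipschitz:
  assumes "0 \<le> r" "r < 1"
  shows "\<bar>cos_poly (wave_freqs M) (wave_coeff r) t - cos_poly (wave_freqs M) (wave_coeff r) t'\<bar>
     \<le> (arctan (2 * r / (1 - r\<^sup>2)) + 2 * r ^ (2 * M) / (1 - r)) * \<bar>t - t'\<bar>"
proof -
  let ?f = "cos_poly (wave_freqs M) (wave_coeff r)"
  let ?f' = "\<lambda>t. - (2 * (\<Sum>m<M. r ^ (2 * m + 1) * sin (real (2 * m + 1) * (3 * t)) / real (2 * m + 1)))"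
  have "(?f has_field_derivative ?f' t) (at t)" for t
  proof -
    have "((\<lambda>t. \<Sum>m<M. wave_coeff r (3 * (2 * m + 1)) * cos (real (3 * (2 * m + 1)) * t)) has_field_derivative
       (\<Sum>m<M. wave_coeff r (3 * (2 * m + 1)) * (- sin (real (3 * (2 * m + 1)) * t) * real (3 * (2 * m + 1))))) (at t)"
      by (auto intro!: derivative_eq_intros sum.cong simp: mult_ac)
    also have "(\<Sum>m<M. wave_coeff r (3 * (2 * m + 1)) * (- sin (real (3 * (2 * m + 1)) * t) * real (3 * (2 * m + 1)))) = ?f' t"
      unfolding sum_distrib_left sum_negf[symmetric]
    proof (intro sum.cong refl)
      fix m :: nat
      define j where "j = 2 * m + 1"
      have "real j \<noteq> 0" by (simp add: j_def)
      then show "wave_coeff r (3 * (2 * m + 1)) * (- sin (real (3 * (2 * m + 1)) * t) * real (3 * (2 * m + 1)))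
          = - (2 * (r ^ (2 * m + 1) * sin (real (2 * m + 1) * (3 * t)) / real (2 * m + 1)))"
        unfolding j_def[symmetric] by (simp add: wave_coeff_def field_simps power2_eq_square)
    qed
    finally show ?thesis
      unfolding cos_poly_def[abs_def] sum_wave_freqs .
  qed
  moreover have "norm (?f' x) \<le> arctan (2 * r / (1 - r\<^sup>2)) + 2 * r ^ (2 * M) / (1 - r)" for x
    using abs_odd_sine_sum_le[OF assms, of "3 * x" M] by (simp only: real_norm_def abs_minus_cancel)
  ultimately have "norm (?f t - ?f t') \<le> (arctan (2 * r / (1 - r\<^sup>2)) + 2 * r ^ (2 * M) / (1 - r)) * norm (t - t')"
    by (rule field_differentiable_bound[OF convex_UNIV has_field_derivative_at_within _ UNIV_I UNIV_I])
  then show ?thesis by simp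
qed

lemma wave_energy:
  "(\<Sum>k\<in>wave_freqs M. (real k - 1) * (wave_coeff r k)\<^sup>2 / 4)
     = (\<Sum>m<M. (r\<^sup>2) ^ (2 * m + 1) * (1 / (3 * real (2 * m + 1) ^ 3) - 1 / (9 * real (2 * m + 1) ^ 4)))"
  unfolding sum_wave_freqs
proof (intro sum.cong refl)
  fix m :: nat
  define j where "j = 2 * m + 1"
  have "real j \<noteq> 0" by (simp add: j_def)
  then show "(real (3 * (2 * m + 1)) - 1) * (wave_coeff r (3 * (2 * m + 1)))\<^sup>2 / 4
     = (r\<^sup>2) ^ (2 * m + 1) * (1 / (3 * real (2 * m + 1) ^ 3) - 1 / (9 * real (2 * m + 1) ^ 4))"
    unfolding j_def[symmetric]
    by (simp add: wave_coeff_def field_simps power2_eq_square power3_eq_cube power4_eq_xxxx power_mult_distrib)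
qed

lemma odd_wave_freqs: "k \<in> wave_freqs M \<Longrightarrow> odd k"
  by (auto simp: wave_freqs_def)

lemma finite_wave_freqs: "finite (wave_freqs M)"
  by (simp add: wave_freqs_def)

section \<open>Sums over odd integers and the numerical value\<close>

text \<open>The product Gamma(y) Gamma(1 - y) sin(pi y) is constant on (0, 1), so its logarithmic
  derivative vanishes.\<close>

lemma Digamma_reflection_real:
  fixes x :: real
  assumes "0 < x" "x < 1"
  shows "Digamma x - Digamma (1 - x) = - pi * cos (pi * x) / sin (pi * x)"
proof -
  have nonpos: "x \<notin> \<int>\<^sub>\<le>\<^sub>0" "1 - x \<notin> \<int>\<^sub>\<le>\<^sub>0" using assms by (auto elim!: nonpos_Ints_cases)
  have eq: "Gamma y * Gamma (1 - y) * sin (pi * y) = pi" if "y \<in> {0<..<1}" for y :: real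
  proof -
    have "complex_of_real (Gamma y * Gamma (1 - y)) = Gamma (complex_of_real y) * Gamma (1 - complex_of_real y)"
      by (metis Gamma_complex_of_real of_real_1 of_real_diff of_real_mult)
    also have "\<dots> = of_real (pi / sin (pi * y))"
      unfolding Gamma_reflection_complex by (simp only: of_real_divide sin_of_real[symmetric] of_real_mult)
    finally have "complex_of_real (Gamma y * Gamma (1 - y)) = of_real (pi / sin (pi * y))" .
    then have "Gamma y * Gamma (1 - y) = pi / sin (pi * y)"
      by (simp only: of_real_eq_iff)
    moreover have "sin (pi * y) > 0"
      using that by (intro sin_gt_zero) auto
    ultimately show ?thesis by simp
  qed
  have "((\<lambda>y. Gamma y * Gamma (1 - y) * sin (pi * y)) has_field_derivative
      Gamma x * Gamma (1 - x) * ((Digamma x - Digamma (1 - x)) * sin (pi * x) + pi * cos (pi * x))) (at x)"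
    using nonpos by (auto intro!: derivative_eq_intros simp: algebra_simps)
  moreover have "((\<lambda>y. Gamma y * Gamma (1 - y) * sin (pi * y)) has_field_derivative 0) (at x)"
  proof (rule has_field_derivative_transform_within_open[of "\<lambda>_. pi" 0 x "{0<..<1}"])
  qed (use eq assms in auto)
  ultimately have "Gamma x * Gamma (1 - x) * ((Digamma x - Digamma (1 - x)) * sin (pi * x) + pi * cos (pi * x)) = 0"
    by (rule DERIV_unique)
  moreover have "Gamma x > 0" "Gamma (1 - x) > 0" using assms by (auto intro: Gamma_real_pos)
  ultimately have "(Digamma x - Digamma (1 - x)) * sin (pi * x) + pi * cos (pi * x) = 0"
    by simp
  moreover have "sin (pi * x) > 0" using assms by (intro sin_gt_zero) auto
  ultimately show ?thesis by (simp add: field_simps)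
qed

text \<open>This allows identities known only on an interval to be differentiated.\<close>

lemma DERIV_eq_on_open_interval:
  fixes f g :: "real \<Rightarrow> real"
  assumes "\<And>y. a < y \<Longrightarrow> y < b \<Longrightarrow> f y = g y" "a < x" "x < b"
    and "(f has_field_derivative f') (at x)" "(g has_field_derivative g') (at x)"
  shows "f' = g'"
proof (rule DERIV_unique[OF assms(4)])
  show "(f has_field_derivative g') (at x)"
    by (rule has_field_derivative_transform_within_open[OF assms(5), of "{a<..<b}"]) (use assms in auto)
qed

text \<open>Differentiate the reflection formula of the digamma function three times.\<close>

lemma Polygamma_3_half: "Polygamma 3 (1 / 2 :: real) = pi ^ 4"
proof -
  have nonpos: "x \<notin> \<int>\<^sub>\<le>\<^sub>0" "1 - x \<notin> \<int>\<^sub>\<le>\<^sub>0" if "0 < x" "x < 1" for x :: real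
    using that by (auto elim!: nonpos_Ints_cases)
  have sin_pos: "sin (pi * x) > 0" if "0 < x" "x < 1" for x
    using that by (intro sin_gt_zero) auto
  have 1: "Polygamma 1 x + Polygamma 1 (1 - x) = pi\<^sup>2 / (sin (pi * x))\<^sup>2" if x: "0 < x" "x < 1" for x :: real
  proof (rule DERIV_eq_on_open_interval[OF Digamma_reflection_real x])
    show "((\<lambda>x. Digamma x - Digamma (1 - x)) has_field_derivative Polygamma 1 x + Polygamma 1 (1 - x)) (at x)"
      using nonpos[OF x] by (auto intro!: derivative_eq_intros)
    show "((\<lambda>x. - pi * cos (pi * x) / sin (pi * x)) has_field_derivative pi\<^sup>2 / (sin (pi * x))\<^sup>2) (at x)"
      using sin_pos[OF x]
      by (auto intro!: derivative_eq_intros simp: field_simps power2_eq_square)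
        (use sin_cos_squared_add[of "pi * x"] in algebra)
  qed auto
  have 2: "Polygamma 2 x - Polygamma 2 (1 - x) = - 2 * pi ^ 3 * cos (pi * x) / (sin (pi * x)) ^ 3"
    if x: "0 < x" "x < 1" for x :: real
  proof (rule DERIV_eq_on_open_interval[OF 1 x])
    show "((\<lambda>x. Polygamma 1 x + Polygamma 1 (1 - x)) has_field_derivative Polygamma 2 x - Polygamma 2 (1 - x)) (at x)"
      using nonpos[OF x] by (auto intro!: derivative_eq_intros simp: numeral_2_eq_2)
    show "((\<lambda>x. pi\<^sup>2 / (sin (pi * x))\<^sup>2) has_field_derivative - 2 * pi ^ 3 * cos (pi * x) / (sin (pi * x)) ^ 3) (at x)"
      using sin_pos[OF x] by (auto intro!: derivative_eq_intros simp: field_simps power2_eq_square power3_eq_cube)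
  qed auto
  have half: "(0::real) < 1 / 2" "(1 / 2 :: real) < 1" by auto
  \<comment> \<open>The reflection fixes 1/2, so both summands agree there.\<close>
  have "Polygamma 3 (1 / 2 :: real) + Polygamma 3 (1 - 1 / 2) = 2 * pi ^ 4"
  proof (rule DERIV_eq_on_open_interval[OF 2 half])
    show "((\<lambda>x. Polygamma 2 x - Polygamma 2 (1 - x)) has_field_derivative Polygamma 3 (1 / 2 :: real) + Polygamma 3 (1 - 1 / 2)) (at (1 / 2))"
      using nonpos[OF half] by (auto intro!: derivative_eq_intros simp: numeral_2_eq_2 numeral_3_eq_3)
    show "((\<lambda>x. - 2 * pi ^ 3 * cos (pi * x) / (sin (pi * x)) ^ 3) has_field_derivative 2 * pi ^ 4) (at (1 / 2))"
      by (auto intro!: derivative_eq_intros simp: field_simps power3_eq_cube power4_eq_xxxx)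
  qed auto
  then show ?thesis by simp
qed

text \<open>The series of \<open>Polygamma 3\<close> at 1/2 is 6 times the sum of 1 / (k + 1/2)^4,
  and scaling by 2 costs the factor 16.\<close>

lemma sums_inverse_odd_fourth_powers: "(\<lambda>m. 1 / real (2 * m + 1) ^ 4) sums (pi ^ 4 / 96)"
proof -
  have "(\<lambda>k. inverse ((1 / 2 + real k) ^ Suc 3)) sums ((- 1) ^ Suc 3 * Polygamma 3 (1 / 2) / fact 3)"
    by (rule Polygamma_LIMSEQ) auto
  then have "(\<lambda>k. inverse ((1 / 2 + real k) ^ 4) / 16) sums (pi ^ 4 / 6 / 16)"
    by (intro sums_divide) (simp add: Polygamma_3_half fact_numeral)
  moreover have "inverse ((1 / 2 + real k) ^ 4) / 16 = 1 / real (2 * k + 1) ^ 4" for k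
  proof -
    have "real (2 * k + 1) = 2 * (1 / 2 + real k)" by simp
    then show ?thesis by (simp only: power_mult_distrib) (simp add: inverse_eq_divide)
  qed
  ultimately show ?thesis by simp
qed

section \<open>Inverse cubes and the value of zeta at 3\<close>

lemma sums_zeta_3: "(\<lambda>k. 1 / real (Suc k) ^ 3) sums zeta 3"
proof -
  have eq: "1 / real (Suc k) powr 3 = 1 / real (Suc k) ^ 3" for k
    by (simp add: powr_numeral)
  have "summable (\<lambda>k. inverse (real (Suc k) ^ 3))"
    using inverse_power_summable[of 3, where 'a = real] by (subst summable_Suc_iff) simp
  then have "summable (\<lambda>k. 1 / real (Suc k) ^ 3)"
    by (simp add: inverse_eq_divide)
  then show ?thesis unfolding zeta_def eq by (rule summable_sums)
qed

text \<open>Grouping consecutive terms in pairs splits off the even ones, which sum to one eighth of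
  \<open>zeta 3\<close>.\<close>

lemma sums_inverse_odd_cubes: "(\<lambda>m. 1 / real (2 * m + 1) ^ 3) sums (7 / 8 * zeta 3)"
proof -
  have "(\<lambda>m. \<Sum>k = m * 2..<m * 2 + 2. 1 / real (Suc k) ^ 3) sums zeta 3"
    by (rule sums_group[OF sums_zeta_3]) simp
  moreover have "(\<Sum>k = m * 2..<m * 2 + 2. 1 / real (Suc k) ^ 3)
      = 1 / real (2 * m + 1) ^ 3 + 1 / 8 * (1 / real (Suc m) ^ 3)" for m
  proof -
    have "real (2 * m + 2) = 2 * real (Suc m)" by simp
    then have "1 / real (2 * m + 2) ^ 3 = 1 / 8 * (1 / real (Suc m) ^ 3)"
      by (simp only: power_mult_distrib) simp
    then show ?thesis by (simp add: numeral_2_eq_2 mult.commute)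
  qed
  ultimately have "(\<lambda>m. 1 / real (2 * m + 1) ^ 3 + 1 / 8 * (1 / real (Suc m) ^ 3)) sums zeta 3"
    by simp
  from sums_diff[OF this sums_mult[OF sums_zeta_3, of "1 / 8"]]
  show ?thesis by simp
qed

lemma sums_wave_energy:
  "(\<lambda>m. 1 / (3 * real (2 * m + 1) ^ 3) - 1 / (9 * real (2 * m + 1) ^ 4)) sums (7 / 24 * zeta 3 - pi ^ 4 / 864)"
  using sums_diff[OF sums_divide[OF sums_inverse_odd_cubes, of 3] sums_divide[OF sums_inverse_odd_fourth_powers, of 9]]
  by (simp add: mult.commute)

text \<open>
  With \<open>x = k + 1\<close>, the summand \<open>1/x\<^sup>3\<close> lies between the telescoping terms \<open>x/(x\<^sup>4 + 1/4)\<close> and \<open>1/(x(x\<^sup>2 - 1))\<close>.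
\<close>

lemma zeta_3_bounds: "zeta 3 < 1.20207" "1.20205 < zeta 3"
proof -
  \<comment> \<open>After 20 exact terms the bounds for the tail are 1/841 and 1/840, less than
    2/10^6 apart.\<close>
  have tail: "(\<lambda>k. 1 / real (Suc (k + 20)) ^ 3) sums (zeta 3 - (\<Sum>k<20. 1 / real (Suc k) ^ 3))"
    by (rule sums_split_initial_segment[OF sums_zeta_3])
  define U where "U = (\<lambda>k. 1 / (2 * (real (k + 20) * (real (k + 20) + 1))))"
  define V where "V = (\<lambda>k. 1 / (2 * (real (k + 20) * (real (k + 20) + 1) + 1 / 2)))"
  have U0: "U \<longlonglongrightarrow> 0" unfolding U_def by real_asymp
  have V0: "V \<longlonglongrightarrow> 0" unfolding V_def by real_asymp
  have U: "(\<lambda>k. U k - U (Suc k)) sums (U 0)" using telescope_sums'[OF U0] by simp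
  have V: "(\<lambda>k. V k - V (Suc k)) sums (V 0)" using telescope_sums'[OF V0] by simp
  have "zeta 3 - (\<Sum>k<20. 1 / real (Suc k) ^ 3) \<le> U 0"
  proof (rule sums_le[OF _ tail U])
    fix k :: nat
    define x where "x = real (Suc (k + 20))"
    have x: "x > 1" by (simp add: x_def)
    then have x2: "x * x > 1" using less_1_mult by blast
    have "U k - U (Suc k) = 1 / (2 * ((x - 1) * x)) - 1 / (2 * (x * (x + 1)))"
      by (simp add: U_def x_def)
    also have "\<dots> = 1 / (x * (x\<^sup>2 - 1))"
      using x x2 by (simp add: divide_simps power2_eq_square) (simp add: algebra_simps)
    also have "\<dots> \<ge> 1 / x ^ 3"
    proof (rule divide_left_mono)
      show "x * (x\<^sup>2 - 1) \<le> x ^ 3" using x by (simp add: power3_eq_cube power2_eq_square algebra_simps)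
      show "0 < x ^ 3 * (x * (x\<^sup>2 - 1))" using x x2 by (intro mult_pos_pos) (auto simp: power2_eq_square)
    qed simp
    finally show "1 / real (Suc (k + 20)) ^ 3 \<le> U k - U (Suc k)" by (simp only: x_def)
  qed
  then show "zeta 3 < 1.20207" by (simp add: U_def lessThan_nat_numeral)
  have "V 0 \<le> zeta 3 - (\<Sum>k<20. 1 / real (Suc k) ^ 3)"
  proof (rule sums_le[OF _ V tail])
    fix k :: nat
    define x where "x = real (Suc (k + 20))"
    have x: "x > 1" by (simp add: x_def)
    have pos: "(x - 1) * x + 1 / 2 > 0" "x * (x + 1) + 1 / 2 > 0" using x by (auto intro!: add_pos_pos)
    have "V k - V (Suc k) = 1 / (2 * ((x - 1) * x + 1 / 2)) - 1 / (2 * (x * (x + 1) + 1 / 2))"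
      by (simp add: V_def x_def)
    also have "\<dots> = ((x * (x + 1) + 1 / 2) - ((x - 1) * x + 1 / 2)) / (2 * ((x - 1) * x + 1 / 2) * (x * (x + 1) + 1 / 2))"
    proof -
      have "1 / (2 * p) - 1 / (2 * q) = (q - p) / (2 * p * q)" if "p > 0" "q > 0" for p q :: real
        using that by (simp add: field_simps)
      then show ?thesis using pos by blast
    qed
    also have "\<dots> = x / (((x - 1) * x + 1 / 2) * (x * (x + 1) + 1 / 2))"
    proof -
      have "(x * (x + 1) + 1 / 2) - ((x - 1) * x + 1 / 2) = 2 * x" by (simp add: algebra_simps)
      moreover have "2 * x / (2 * p * q) = x / (p * q)" for p q by simp
      ultimately show ?thesis by (simp only:)
    qed
    \<comment> \<open>This is the Sophie Germain factorisation.\<close>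
    also have "((x - 1) * x + 1 / 2) * (x * (x + 1) + 1 / 2) = x ^ 4 + 1 / 4"
      by (simp add: algebra_simps power4_eq_xxxx)
    also have "x / (x ^ 4 + 1 / 4) \<le> x / x ^ 4"
      using x by (intro divide_left_mono) (auto intro!: mult_pos_pos add_pos_pos)
    also have "\<dots> = 1 / x ^ 3"
      using x by (simp add: power3_eq_cube power4_eq_xxxx)
    finally show "V k - V (Suc k) \<le> 1 / real (Suc (k + 20)) ^ 3" by (simp only: x_def)
  qed
  then show "1.20205 < zeta 3" by (simp add: V_def lessThan_nat_numeral)
qed

section \<open>Numerical evaluation of the bound\<close>

lemma exp_taylor_8_bounds:
  fixes x :: real
  assumes "0 \<le> x" "x \<le> 1"
  shows "(\<Sum>m<8. x ^ m / fact m) \<le> exp x" and "exp x \<le> (\<Sum>m<8. x ^ m / fact m) + 3 / fact 8 * x ^ 8"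
proof -
  obtain t where t: "\<bar>t\<bar> \<le> \<bar>x\<bar>" "exp x = (\<Sum>m<8. x ^ m / fact m) + exp t / fact 8 * x ^ 8"
    using Maclaurin_exp_le[of x 8] by blast
  have "exp t \<le> exp 1" using t assms by simp
  then have "exp t \<le> 3" using exp_le by linarith
  then have "exp t / fact 8 * x ^ 8 \<le> 3 / fact 8 * x ^ 8"
    using assms by (intro mult_right_mono divide_right_mono) auto
  then show "exp x \<le> (\<Sum>m<8. x ^ m / fact m) + 3 / fact 8 * x ^ 8" using t by simp
  have "0 \<le> exp t / fact 8 * x ^ 8" using assms by simp
  then show "(\<Sum>m<8. x ^ m / fact m) \<le> exp x" using t by simp
qed

text \<open>The exponent is confined to an interval of length 7/10^6, narrow enough for its
  exponential to stay in the stated window of length 10/10^6.\<close>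

lemma bound_numerical_value:
  "\<bar>exp (7 / 24 * zeta 3 - pi ^ 4 / 864) - 1.26853\<bar> < 5 / 10 ^ 6"
proof -
  let ?x = "7 / 24 * zeta 3 - pi ^ 4 / 864"
  have "3.141592 ^ 4 \<le> pi ^ 4" "pi ^ 4 \<le> 3.141593 ^ 4"
    using pi_bounds by (auto intro!: power_mono)
  then have "97.40900 \<le> pi ^ 4" "pi ^ 4 \<le> 97.40914"
    by (simp_all add: power4_eq_xxxx)
  then have x: "0.237855 \<le> ?x" "?x \<le> 0.237862"
    using zeta_3_bounds by simp_all
  have "exp ?x \<le> exp 0.237862" using x by simp
  also have "\<dots> < 1.268535"
    by (rule le_less_trans[OF exp_taylor_8_bounds(2)]) (simp_all add: lessThan_nat_numeral fact_numeral power_divide)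
  finally have "exp ?x < 1.268535" .
  moreover have "1.268525 < exp ?x"
  proof -
    have "1.268525 < exp (0.237855 :: real)"
      by (rule less_le_trans[OF _ exp_taylor_8_bounds(1)]) (simp_all add: lessThan_nat_numeral fact_numeral power_divide)
    also have "\<dots> \<le> exp ?x" using x by simp
    finally show ?thesis .
  qed
  ultimately show ?thesis unfolding abs_less_iff by simp
qed

section \<open>The lower bound\<close>

text \<open>For a fixed cosine polynomial, the diameter condition and the product estimate both hold
  once \<open>n\<close> is large, and the error in the exponent is \<open>C / n\<close>.\<close>

lemma eventually_Delta_max_bar_ge:
  fixes K :: "nat set" and a :: "nat \<Rightarrow> real" and s :: real
  defines "G \<equiv> \<Sum>k\<in>K. (real k - 1) * (a k)\<^sup>2 / 4"
  assumes K: "finite K" "\<And>k. k \<in> K \<Longrightarrow> odd k"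
    and lip: "\<And>t t'. \<bar>cos_poly K a t - cos_poly K a t'\<bar> \<le> s * \<bar>t - t'\<bar>" and s: "s < pi / 2"
    and y: "y < exp G"
  shows "eventually (\<lambda>n. even n \<longrightarrow> y < Delta_max_bar n) sequentially"
proof -
  define B where "B = (\<Sum>k\<in>K. \<bar>a k\<bar>)"
  define B' where "B' = (\<Sum>k\<in>K. \<bar>a k\<bar> * real k)"
  define C where "C = B'\<^sup>2 / 2 + 2 * B' ^ 3"
  have inv: "(\<lambda>n. c / real n) \<longlonglongrightarrow> 0" for c
    by (rule lim_const_over_n)
  have "(\<lambda>n. exp (G - C / real n)) \<longlonglongrightarrow> exp (G - 0)"
    by (intro tendsto_intros inv)
  then have ev1: "eventually (\<lambda>n. y < exp (G - C / real n)) sequentially"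
    using y by (intro order_tendstoD(1)) auto
  have "(\<lambda>n. 2 * s * (1 + B / 2 / real n)) \<longlonglongrightarrow> 2 * s * (1 + 0)"
    by (intro tendsto_intros inv)
  moreover have "(\<lambda>n. pi * ((1 - B / real n)\<^sup>2 * (1 - (pi / real n)\<^sup>2 / 3))) \<longlonglongrightarrow> pi * ((1 - 0)\<^sup>2 * (1 - 0\<^sup>2 / 3))"
    by (intro tendsto_intros inv) auto
  ultimately have "(\<lambda>n. pi * ((1 - B / real n)\<^sup>2 * (1 - (pi / real n)\<^sup>2 / 3)) - 2 * s * (1 + B / 2 / real n))
      \<longlonglongrightarrow> pi * ((1 - 0)\<^sup>2 * (1 - 0\<^sup>2 / 3)) - 2 * s * (1 + 0)"
    by (intro tendsto_diff)
  \<comment> \<open>In the limit the condition reads 2 s < pi, which is strict and therefore holds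
    eventually.\<close>
  then have ev2: "eventually (\<lambda>n. 0 < pi * ((1 - B / real n)\<^sup>2 * (1 - (pi / real n)\<^sup>2 / 3)) - 2 * s * (1 + B / 2 / real n)) sequentially"
    using s by (intro order_tendstoD(1)) auto
  have ev3: "eventually (\<lambda>n. B < real n) sequentially" "eventually (\<lambda>n. 2 * B' < real n) sequentially"
    using filterlim_real_sequentially by (auto simp: filterlim_at_top_dense)
  have ev4: "eventually (\<lambda>n. \<forall>k\<in>K. 2 * k < n) sequentially"
    using K(1) by (intro eventually_ball_finite) (auto intro: eventually_gt_at_top)
  show ?thesis
    using ev1 ev2 ev3 ev4 eventually_ge_at_top[of 13]
  proof eventually_elim
    case (elim n)
    show ?case
    proof
      assume n: "even n"
      let ?z = "perturbed_polygon K a n"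
      have "?z \<in> configs n"
        by (rule perturbed_polygon_in_configs[OF K(2) lip n]) (use elim in \<open>auto simp: B_def\<close>)
      then have "Delta n ?z \<le> Delta_max n"
        unfolding Delta_max_def by (intro cSUP_upper bdd_above_Delta)
      moreover have "real n ^ n * exp (G - C / n) \<le> Delta n ?z"
        unfolding G_def C_def B'_def
      proof (rule Delta_perturbed_polygon_ge[OF K(1)])
        show "0 \<notin> K" using K(2) by force
        show "(\<Sum>k\<in>K. \<bar>a k\<bar> * real k) / n \<le> 1 / 2"
          using elim by (simp add: B'_def field_simps)
      qed (use elim in auto)
      ultimately have "exp (G - C / n) \<le> Delta_max_bar n"
        using elim by (simp add: Delta_max_bar_def field_simps)
      then show "y < Delta_max_bar n" using elim by linarith
    qed
  qed
qed

text \<open>The order of choices matters: first \<open>M0\<close> such that the partial sum at r = 1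
  is large enough, then \<open>r\<close> close to 1, then \<open>M \<ge> M0\<close> such that the
  truncation error keeps the Lipschitz constant below pi/2.\<close>

lemma eventually_Delta_max_bar_gt:
  assumes "y < exp (7 / 24 * zeta 3 - pi ^ 4 / 864)"
  shows "eventually (\<lambda>n. even n \<longrightarrow> y < Delta_max_bar n) sequentially"
proof -
  define e where "e = (\<lambda>m. 1 / (3 * real (2 * m + 1) ^ 3) - 1 / (9 * real (2 * m + 1) ^ 4))"
  have e_nonneg: "e m \<ge> 0" for m
  proof -
    define j where "j = real (2 * m + 1)"
    have j: "j \<ge> 1" by (simp add: j_def)
    then have "3 * j ^ 3 \<le> 9 * j ^ 4"
      using mult_mono[of 3 "9 * j" "j ^ 3" "j ^ 3"] by (simp add: power3_eq_cube power4_eq_xxxx)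
    then have "1 / (9 * j ^ 4) \<le> 1 / (3 * j ^ 3)"
      using j by (intro divide_left_mono) auto
    then show ?thesis by (simp add: e_def j_def)
  qed
  have "(\<lambda>M. exp (\<Sum>m<M. e m)) \<longlonglongrightarrow> exp (7 / 24 * zeta 3 - pi ^ 4 / 864)"
    using sums_wave_energy unfolding e_def sums_def by (rule tendsto_exp)
  from order_tendstoD(1)[OF this assms]
  obtain M0 where M0: "y < exp (\<Sum>m<M0. e m)"
    by (auto simp: eventually_sequentially)
  have "((\<lambda>r. exp (\<Sum>m<M0. (r\<^sup>2) ^ (2 * m + 1) * e m)) \<longlongrightarrow> exp (\<Sum>m<M0. (1\<^sup>2) ^ (2 * m + 1) * e m)) (at_left 1)"
    by (intro tendsto_intros)
  then have "eventually (\<lambda>r. y < exp (\<Sum>m<M0. (r\<^sup>2) ^ (2 * m + 1) * e m)) (at_left 1)"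
    using M0 by (intro order_tendstoD(1)) auto
  moreover have "eventually (\<lambda>r. r \<in> {0<..<1}) (at_left (1 :: real))"
    by (rule eventually_at_leftI[of 0]) auto
  ultimately have "eventually (\<lambda>r. y < exp (\<Sum>m<M0. (r\<^sup>2) ^ (2 * m + 1) * e m) \<and> r \<in> {0<..<1}) (at_left 1)"
    by (rule eventually_conj)
  then obtain r where r: "y < exp (\<Sum>m<M0. (r\<^sup>2) ^ (2 * m + 1) * e m)" "0 < r" "r < 1"
    using eventually_happens'[OF trivial_limit_at_left_real] by auto
  have "(\<lambda>M. 2 * (r\<^sup>2) ^ M / (1 - r)) \<longlonglongrightarrow> 2 * 0 / (1 - r)"
    using r by (intro tendsto_intros LIMSEQ_realpow_zero) (auto simp: abs_square_less_1 power_less_one_iff)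
  then have "(\<lambda>M. arctan (2 * r / (1 - r\<^sup>2)) + 2 * r ^ (2 * M) / (1 - r)) \<longlonglongrightarrow> arctan (2 * r / (1 - r\<^sup>2)) + 0"
    by (intro tendsto_intros) (simp add: power_mult)
  then have "eventually (\<lambda>M. arctan (2 * r / (1 - r\<^sup>2)) + 2 * r ^ (2 * M) / (1 - r) < pi / 2) sequentially"
    using arctan_ubound by (intro order_tendstoD(2)) auto
  then obtain M where M: "arctan (2 * r / (1 - r\<^sup>2)) + 2 * r ^ (2 * M) / (1 - r) < pi / 2" "M \<ge> M0"
    unfolding eventually_sequentially by (meson nle_le)
  \<comment> \<open>All terms are nonnegative, so passing from \<open>M0\<close> to \<open>M\<close>
    loses nothing.\<close>
  have "(\<Sum>m<M0. (r\<^sup>2) ^ (2 * m + 1) * e m) \<le> (\<Sum>m<M. (r\<^sup>2) ^ (2 * m + 1) * e m)"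
    using M(2) e_nonneg by (intro sum_mono2) auto
  then have "y < exp (\<Sum>m<M. (r\<^sup>2) ^ (2 * m + 1) * e m)"
    using r(1) by (meson exp_le_cancel_iff less_le_trans)
  then have "y < exp (\<Sum>k\<in>wave_freqs M. (real k - 1) * (wave_coeff r k)\<^sup>2 / 4)"
    by (simp only: wave_energy e_def)
  then show ?thesis
    by (intro eventually_Delta_max_bar_ge[OF finite_wave_freqs odd_wave_freqs wave_lipschitz M(1)])
       (use r in auto)
qed

lemma Liminf_Delta_max_bar_ge:
  "ereal (exp (7 / 24 * zeta 3 - pi ^ 4 / 864))
     \<le> Liminf (inf sequentially (principal {n. even n})) (\<lambda>n. ereal (Delta_max_bar n))"
  unfolding le_Liminf_iff eventually_inf_principal
proof (intro allI impI)
  fix y :: ereal assume y: "y < ereal (exp (7 / 24 * zeta 3 - pi ^ 4 / 864))"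
  \<comment> \<open>\<open>y\<close> may be -\<infinity>, so a real number is inserted between it
    and the bound.\<close>
  then obtain y' where y': "y < ereal y'" "y' < exp (7 / 24 * zeta 3 - pi ^ 4 / 864)"
    using ereal_dense2[OF y] by auto
  show "eventually (\<lambda>n. n \<in> {n. even n} \<longrightarrow> y < ereal (Delta_max_bar n)) sequentially"
    using eventually_Delta_max_bar_gt[OF y'(2)]
    by eventually_elim (use y'(1) in \<open>auto intro: less_trans\<close>)
qed

theorem theorem1p3:
  shows "Liminf (inf sequentially (principal {n. even n})) (\<lambda>n. ereal (Delta_max_bar n))
           \<ge> ereal (exp (7 / 24 * zeta 3 - pi ^ 4 / 864))
         \<and> \<bar>exp (7 / 24 * zeta 3 - pi ^ 4 / 864) - 1.26853\<bar> < 5 / 10 ^ 6"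
  using Liminf_Delta_max_bar_ge bound_numerical_value by blast

end
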